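(* Let $(m,n)\in\mathbb{Z}\times\mathbb{N}$ and let $f,g\in\mathcal{C}^1(\mathbb{R}^2)$ be supported in $\mathbb{B}_{1/2}^\circ$. Then there exist constants $\gamma_{m,n}>0$ (depending only on $(m,n)$) and $d_{f,g}>0$ (depending only on $f,g$) such that $$\left|C_{m,n}^{K}[f,g]-C_{m,n}(f\ast g)\right|\le\frac{2\gamma_{m,n}d_{f,g}}{K}\qquad\text{for every }K\in\mathbb{N}\text{ with }K\ge K_{m,n}.$$
   Context: $\mathbb{N}=\{1,2,\dots\}$. $\mathbb{B}^\circ_{1/2}=\{\mathbf{x}\in\mathbb{R}^2:\|\mathbf{x}\|_2<\frac12\}$. $\mathrm{supp}(f)=\{\mathbf{x}: f(\mathbf{x})\neq 0\}$ and $f$ is supported in $X$ if $\mathrm{supp}(f)\subseteq X$. $\mathcal{C}^1(\mathbb{R}^2)$ is the set of functions $\mathbb{R}^2\to\mathbb{C}$ all of whose partial derivatives of order $\le 1$ exist and are continuous. $(f\ast g)(\mathbf{x})=\int_{\mathbb{R}^2}f(\mathbf{y})g(\mathbf{x}-\mathbf{y})\,d\mathbf{y}$. Bessel notation: $J_m$ is the Bessel function of the first kind of order $m\in\mathbb{Z}$, $0<z_{m,1}<z_{m,2}<\cdots$ are its positive zeros, and $K_{m,n}:=\lceil z_{m,n}/\pi\rceil$. In polar coordinates, $\Psi_{m,n}(r,\theta)=\frac{e^{\mathrm{i}m\theta}J_m(z_{m,n}r)}{\sqrt{\pi}\,|J_{m+1}(z_{m,n})|}$ if $r\le 1$, and $0$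 if $r>1$. The Fourier-Bessel coefficient is $C_{m,n}(h)=\int_0^{2\pi}\int_0^1 h(r,\theta)\overline{\Psi_{m,n}(r,\theta)}\,r\,dr\,d\theta$. Finite Fourier transform: for $L\in\mathbb{N}$, $\mathbf{k}\in\mathbb{Z}^2$, $\widehat f(\mathbf{k};L)=\delta^2\sum_{i=1}^L\sum_{j=1}^L f(x_i,x_j)e^{-\pi\mathrm{i}(k_1x_i+k_2x_j)}$ with $\delta=2/L$, $x_i=-1+(i-1)\delta$. Coefficients: for $\mathbf{k}=(k_1,k_2)\in\mathbb{Z}^2$, $\mathbf{c}(\mathbf{k};m,n)=\varepsilon_m\sqrt{\pi}(-1)^n\mathrm{i}^m z_{m,n}\frac{J_m(\pi\|\mathbf{k}\|_2)e^{-\mathrm{i}m\Phi(\mathbf{k})}}{2(\pi^2\|\mathbf{k}\|_2^2-z_{m,n}^2)}$, where $\varepsilon_m=1$ if $m\ge0$, $\varepsilon_m=(-1)^m$ if $m<0$, and $\Phi(\mathbf{k})=\mathrm{atan2}(k_2,k_1)$ is the polar angle of $\mathbf{k}$ (with value $0$ at $\mathbf{k}=0$). If $\pi\|\mathbf{k}\|_2=z_{m,n}$, the quotient $J_m(\pi\|\mathbf{k}\|_2)/(\pi^2\|\mathbf{k}\|_2^2-z_{m,n}^2)$ is understood as its limiting value $J_m'(z_{m,n})/(2z_{m,n})$. For $K\in\mathbb{N}$: $C_{m,n}^K[f,g]=\sum_{\mathbf{k}\in\mathbb{Z}^2,\ \|\mathbf{k}\|_\infty\le K}\mathbf{c}(\mathbf{k};m,n)\,\widehat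 f(\mathbf{k};2K+1)\,\widehat g(\mathbf{k};2K+1)$. *)

theory Defs
  imports "HOL-Analysis.Analysis"
begin

text \<open>
  The plane is \<^typ>\<open>real \<times> real\<close>, whose norm is the Euclidean one. The natural numbers of the
  source start at 1; indices and parameters of type \<^typ>\<open>nat\<close> are restricted accordingly
  where they are used.
\<close>

definition C1_plane :: "(real \<times> real \<Rightarrow> complex) \<Rightarrow> bool" where
  "C1_plane f \<longleftrightarrow> continuous_on UNIV f \<and>
    (\<exists>f1 f2. continuous_on UNIV f1 \<and> continuous_on UNIV f2 \<and>
      (\<forall>x y. ((\<lambda>t. f (t, y)) has_vector_derivative f1 (x, y)) (at x)) \<and>
      (\<forall>x y. ((\<lambda>t. f (x, t)) has_vector_derivative f2 (x, y)) (at y)))"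

definition supp :: "(real \<times> real \<Rightarrow> complex) \<Rightarrow> (real \<times> real) set" where
  "supp f = {x. f x \<noteq> 0}"

definition plane_conv ::
  "(real \<times> real \<Rightarrow> complex) \<Rightarrow> (real \<times> real \<Rightarrow> complex) \<Rightarrow> real \<times> real \<Rightarrow> complex" where
  "plane_conv f g x = (LINT y|lborel. f y * g (x - y))"

text \<open>
  The power series of the Bessel function of the first kind, for all integer orders. For negative
  order the reciprocal Gamma function vanishes in every term with \<open>k + m < 0\<close>, so no
  negative power of \<^term>\<open>x\<close> contributes.
\<close>

definition bessel_J :: "int \<Rightarrow> real \<Rightarrow> real" where
  "bessel_J m x =
    (\<Sum>k. (- 1) ^ k / fact k * rGamma (of_int m + of_nat k + 1) * (x / 2) powi (2 * int k + m))"

text \<open>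
  The \<open>n\<close>-th positive zero in increasing order, for \<open>n \<ge> 1\<close>: the positive zero below or at which
  there are exactly \<open>n\<close> positive zeros.
\<close>

definition bessel_zero :: "int \<Rightarrow> nat \<Rightarrow> real" where
  "bessel_zero m n =
    (THE z. 0 < z \<and> bessel_J m z = 0 \<and> card {x. 0 < x \<and> x \<le> z \<and> bessel_J m x = 0} = n)"

definition K_min :: "int \<Rightarrow> nat \<Rightarrow> int" where
  "K_min m n = \<lceil>bessel_zero m n / pi\<rceil>"

definition Psi :: "int \<Rightarrow> nat \<Rightarrow> real \<Rightarrow> real \<Rightarrow> complex" where
  "Psi m n r \<theta> =
    (if r \<le> 1
     then exp (\<i> * of_int m * of_real \<theta>) * of_real (bessel_J m (bessel_zero m n * r)) /
       of_real (sqrt pi * \<bar>bessel_J (m + 1) (bessel_zero m n)\<bar>)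
     else 0)"

definition FB_coeff :: "int \<Rightarrow> nat \<Rightarrow> (real \<times> real \<Rightarrow> complex) \<Rightarrow> complex" where
  "FB_coeff m n h =
    (LBINT \<theta>:{0..2 * pi}. (LBINT r:{0..1}.
      h (r * cos \<theta>, r * sin \<theta>) * cnj (Psi m n r \<theta>) * of_real r))"

definition finite_fourier :: "(real \<times> real \<Rightarrow> complex) \<Rightarrow> int \<times> int \<Rightarrow> nat \<Rightarrow> complex" where
  "finite_fourier f k L =
    (let \<delta> = 2 / real L; x = (\<lambda>i::nat. - 1 + (real i - 1) * \<delta>)
     in of_real (\<delta>\<^sup>2) * (\<Sum>i=1..L. \<Sum>j=1..L. f (x i, x j) *
          exp (- (of_real pi * \<i> * of_real (of_int (fst k) * x i + of_int (snd k) * x j)))))"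

definition knorm :: "int \<times> int \<Rightarrow> real" where
  "knorm k = norm (real_of_int (fst k), real_of_int (snd k))"

text \<open>
  \<^const>\<open>Arg\<close> takes values in \<open>(-\<pi>, \<pi>]\<close> and is 0 at the origin.
\<close>

definition kangle :: "int \<times> int \<Rightarrow> real" where
  "kangle k = Arg (Complex (of_int (fst k)) (of_int (snd k)))"

text \<open>
  The quotient \<open>J\<^sub>m(t) / (t\<^sup>2 - z\<^sup>2)\<close>, extended to \<open>t = z\<close> by its limit.
\<close>

definition bessel_quot :: "int \<Rightarrow> nat \<Rightarrow> real \<Rightarrow> real" where
  "bessel_quot m n t =
    (let z = bessel_zero m n
     in if t = z then deriv (bessel_J m) z / (2 * z) else bessel_J m t / (t\<^sup>2 - z\<^sup>2))"

definition c_coeff :: "int \<times> int \<Rightarrow> int \<Rightarrow> nat \<Rightarrow> complex" where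
  "c_coeff k m n =
    (if 0 \<le> m then 1 else (- 1) powi m) * of_real (sqrt pi) * (- 1) ^ n * \<i> powi m *
    of_real (bessel_zero m n) *
    (of_real (bessel_quot m n (pi * knorm k)) * exp (- (\<i> * of_int m * of_real (kangle k)))) / 2"

definition FB_approx :: "nat \<Rightarrow> int \<Rightarrow> nat \<Rightarrow>
    (real \<times> real \<Rightarrow> complex) \<Rightarrow> (real \<times> real \<Rightarrow> complex) \<Rightarrow> complex" where
  "FB_approx K m n f g =
    (\<Sum>k \<in> {k. max \<bar>fst k\<bar> \<bar>snd k\<bar> \<le> int K}.
      c_coeff k m n * finite_fourier f k (2 * K + 1) * finite_fourier g k (2 * K + 1))"

end

theory Submission
  imports Defs
begin

text \<open>
  Let \<open>P\<close> be the trigonometric polynomial with coefficients \<open>f^(k; L) g^(k; L) / 4\<close>, \<open>L = 2 K + 1\<close>. The Bessel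
  integral (angular part) and Lommel's integral (radial part) show that \<open>c(k; m, n)\<close> is a quarter of
  the Fourier-Bessel coefficient of the plane wave \<open>exp (\<i> \<pi> k \<bullet> x)\<close>; here the factor \<open>(- 1) ^ n\<close> is the
  sign of \<open>J\<^sub>m'\<close> at its \<open>n\<close>-th zero, the zeros being simple. Hence the approximation is
  exactly the Fourier-Bessel coefficient of \<open>P\<close>, and it suffices to bound \<open>P - f * g\<close> by \<open>O(1 / K)\<close>
  uniformly on the disc. At points of the lattice \<open>(2 / L) \<int>\<^sup>2\<close>, \<open>P\<close> equals the Riemann sum of the
  integral \<open>f * g\<close>, whose error is \<open>O(1 / K)\<close> because \<open>f\<close> and \<open>g\<close> are Lipschitz. Between lattice
  points, \<open>P\<close> is Lipschitz uniformly in \<open>K\<close>: the sum of \<open>|k| |f^(k; L)| |g^(k; L)|\<close> is bounded by the discrete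
  Parseval identity, applied to \<open>g\<close> and to the difference quotients of \<open>f\<close>.
\<close>

section \<open>Bessel functions of natural order\<close>

text \<open>The coefficient functional is bounded in the sup norm on the disc, so no asymptotics of
  Bessel functions or of their zeros enter. What is needed of the zeros is existence, simplicity,
  and the alternating sign of the derivative. For functions that are only of class C^1, a comparison
  with exact Fourier coefficients, frequency by frequency, would have to control aliasing of slowly
  decaying coefficients. Comparing values in space avoids this: as \<open>L\<close> is odd, the
  frequencies from -K to K form a complete residue system modulo \<open>L\<close>, and at lattice
  points the polynomial is exactly a cyclic convolution of period 2. The supports turn the cyclic
  convolution into the ordinary one: for |x| <= 1 and |y| < 1/2 in each coordinate, x - y has
  modulus below 3/2, so its translates by nonzero multiples of 2 stay outside the support of
  \<open>g\<close>. The quarter is the reciprocal area of the period square [-1, 1]^2, as in a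
  Fourier series.\<close>

definition bessel_G :: "nat \<Rightarrow> real \<Rightarrow> real" where
  "bessel_G p y = (\<Sum>k. (- 1) ^ k / (fact k * fact (k + p)) * y ^ k)"

text \<open>This is J_p. Splitting off the power of x / 2 leaves the Bessel-Clifford function at -
  x^2 / 4, an everywhere convergent power series whose derivative merely raises the order.\<close>

definition bessel_B :: "nat \<Rightarrow> real \<Rightarrow> real" where
  "bessel_B p x = (x / 2) ^ p * bessel_G p (x\<^sup>2 / 4)"

lemma summable_bessel_G: "summable (\<lambda>k. (- 1) ^ k / (fact k * fact (k + p)) * y ^ k :: real)"
proof (rule summable_comparison_test')
  show "summable (\<lambda>k. \<bar>y\<bar> ^ k / fact k)"
    using summable_exp[of "\<bar>y\<bar>"] by (simp add: field_simps)
  fix k :: nat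
  have "\<bar>y\<bar> ^ k / (fact k * fact (k + p)) \<le> \<bar>y\<bar> ^ k / (fact k * 1)"
    by (intro divide_left_mono mult_left_mono fact_ge_1) auto
  then show "norm ((- 1) ^ k / (fact k * fact (k + p)) * y ^ k) \<le> \<bar>y\<bar> ^ k / fact k"
    by (simp add: abs_mult power_abs)
qed

lemma bessel_G_0: "bessel_G p 0 = 1 / fact p"
  unfolding bessel_G_def powser_zero by simp

lemma DERIV_bessel_G: "(bessel_G p has_real_derivative - bessel_G (Suc p) y) (at y)"
proof -
  let ?c = "\<lambda>k. (- 1) ^ k / (fact k * fact (k + p)) :: real"
  have "((\<lambda>y. \<Sum>k. ?c k * y ^ k) has_real_derivative (\<Sum>k. diffs ?c k * y ^ k)) (at y)"
    by (rule termdiffs_strong_converges_everywhere) (rule summable_bessel_G)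
  moreover have "diffs ?c k * y ^ k = - ((- 1) ^ k / (fact k * fact (k + Suc p)) * y ^ k)" for k
  proof -
    have "fact (Suc k + p) = (fact (k + Suc p) :: real)" by simp
    then show ?thesis by (simp add: diffs_def del: fact_Suc add: fact_Suc[of k])
  qed
  ultimately show ?thesis
    using summable_bessel_G[of "Suc p" y] unfolding bessel_G_def[abs_def] by (simp add: suminf_minus)
qed

text \<open>Comparison of coefficients: multiplication by \<open>y\<close> shifts the series of
  order p + 2 by one index, and (p + 1) / (k! (k + p + 1)!) + 1 / ((k - 1)! (k + p + 1)!) = 1 / (k!
  (k + p)!).\<close>

lemma bessel_G_rec:
  "bessel_G p y = real (Suc p) * bessel_G (Suc p) y - y * bessel_G (Suc (Suc p)) y"
proof -
  let ?t = "\<lambda>p k. (- 1) ^ k / (fact k * fact (k + p)) * y ^ k :: real"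
  let ?s = "\<lambda>k. if k = 0 then 0 else - y * ?t (Suc (Suc p)) (k - 1)"
  have S: "(\<lambda>k. ?t p k) sums bessel_G p y" for p
    unfolding bessel_G_def by (rule summable_sums) (rule summable_bessel_G)
  have "(\<lambda>k. ?s (Suc k)) sums (- y * bessel_G (Suc (Suc p)) y)"
    using sums_mult[OF S[of "Suc (Suc p)"], of "- y"] by (simp only: nat.simps if_False diff_Suc_1)
  then have "?s sums (- y * bessel_G (Suc (Suc p)) y)"
    using sums_Suc_iff[of ?s] by simp
  from sums_add[OF sums_mult[OF S[of "Suc p"], of "real (Suc p)"] this]
  have "(\<lambda>k. real (Suc p) * ?t (Suc p) k + ?s k) sums
      (real (Suc p) * bessel_G (Suc p) y - y * bessel_G (Suc (Suc p)) y)" by simp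
  moreover have "real (Suc p) * ?t (Suc p) k + ?s k = ?t p k" for k
  proof (cases k)
    case (Suc j)
    define F :: real where "F = fact (k + p)"
    have F: "F > 0" and Fs: "fact (k + Suc p) = (real k + real p + 1) * F"
        "fact (j + Suc (Suc p)) = (real k + real p + 1) * F" "fact k = real k * fact j"
      proof -
      show "F > 0" unfolding F_def by (rule fact_gt_zero)
      show "fact (k + Suc p) = (real k + real p + 1) * F" by (simp add: F_def algebra_simps)
      moreover have "j + Suc (Suc p) = k + Suc p" using Suc by simp
      ultimately show "fact (j + Suc (Suc p)) = (real k + real p + 1) * F" by (simp only:)
      show "fact k = real k * fact j" using Suc by simp
    qed
    have "(real p + 1) * (s * y / (real k * f * (q * F))) + y * (s / (f * (q * F))) = s * y / (real k * f * F)"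
      if "f > 0" "q = real k + real p + 1" for f q s :: real
    proof -
      have "(real p + 1) * (s * y / (real k * f * (q * F))) + y * (s / (f * (q * F)))
          = (s * y / (real k * f * F)) * (((real p + 1) + real k) / q)"
        using that F Suc by (simp add: divide_simps) (simp add: algebra_simps)
      moreover have "((real p + 1) + real k) / q = 1" using that by simp
      ultimately show ?thesis by simp
    qed
    note step = this
    define s where "s = - ((- 1) ^ j * y ^ j)"
    have s: "(- 1) ^ k * y ^ k = s * y" "(- 1) ^ j * y ^ j = - s"
      using Suc by (simp_all add: s_def)
    have "(real p + 1) * ((- 1) ^ k * y ^ k / (real k * fact j * ((real k + real p + 1) * F)))
        - y * ((- 1) ^ j * y ^ j / (fact j * ((real k + real p + 1) * F)))
        = (- 1) ^ k * y ^ k / (real k * fact j * F)"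
      unfolding s using step[of "fact j" "real k + real p + 1" s] by simp
    moreover have "k \<noteq> 0" "k - 1 = j" using Suc by auto
    ultimately show ?thesis
      by (simp only: if_False Fs F_def[symmetric]) (simp add: add.commute)
  qed simp
  ultimately show ?thesis using sums_unique2[OF S[of p]] by (simp only:)
qed

lemma bessel_B_sums:
  "(\<lambda>k. (- 1) ^ k / (fact k * fact (k + p)) * (x / 2) ^ (2 * k + p)) sums bessel_B p x"
proof -
  have "(\<lambda>k. (x / 2) ^ p * ((- 1) ^ k / (fact k * fact (k + p)) * (x\<^sup>2 / 4) ^ k)) sums bessel_B p x"
    unfolding bessel_B_def bessel_G_def by (intro sums_mult summable_sums summable_bessel_G)
  moreover have "(x / 2) ^ p * ((x\<^sup>2 / 4) ^ k) = (x / 2) ^ (2 * k + p)" for k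
  proof -
    have "(x / 2)\<^sup>2 = x\<^sup>2 / 4" by (simp add: power_divide)
    then have "(x / 2) ^ (2 * k) = (x\<^sup>2 / 4) ^ k" by (simp only: power_mult)
    then show ?thesis by (simp only: power_add mult.commute)
  qed
  ultimately show ?thesis by (simp add: mult.assoc mult.left_commute)
qed

text \<open>
  The derivative of \<open>bessel_B p\<close>. The truncated exponent at \<open>p = 0\<close> is harmless, as the term has
  the factor \<open>p\<close>.
\<close>

definition bessel_D :: "nat \<Rightarrow> real \<Rightarrow> real" where
  "bessel_D p x = real p / 2 * (x / 2) ^ (p - 1) * bessel_G p (x\<^sup>2 / 4) - bessel_B (Suc p) x"

lemma DERIV_bessel_B: "(bessel_B p has_real_derivative bessel_D p x) (at x)"
proof -
  have *: "((\<lambda>x. bessel_G p (x\<^sup>2 / 4)) has_real_derivative - bessel_G (Suc p) (x\<^sup>2 / 4) * (x / 2)) (at x)"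
    by (rule DERIV_chain2[OF DERIV_bessel_G]) (auto intro!: derivative_eq_intros)
  have "((\<lambda>x. (x / 2) ^ p * bessel_G p (x\<^sup>2 / 4)) has_real_derivative bessel_D p x) (at x)"
    by (rule derivative_eq_intros * refl | simp)+ (simp add: bessel_D_def bessel_B_def field_simps)
  then show ?thesis unfolding bessel_B_def[abs_def] .
qed

text \<open>The ladder relations, here and in \<open>bessel_D_raise\<close>, carry the factor
  \<open>x\<close> so that they hold at 0 without division.\<close>

lemma bessel_D_lower: "x * bessel_D p x = real p * bessel_B p x - x * bessel_B (Suc p) x"
proof (cases p)
  case (Suc q)
  then show ?thesis by (simp add: bessel_D_def bessel_B_def algebra_simps)
qed (simp add: bessel_D_def)

lemma bessel_D_raise: "x * bessel_D (Suc p) x = x * bessel_B p x - real (Suc p) * bessel_B (Suc p) x"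
proof -
  have "bessel_B (Suc p) x * (2 * real (Suc p)) = x * bessel_B p x + x * bessel_B (Suc (Suc p)) x"
    unfolding bessel_B_def bessel_G_rec[of p "x\<^sup>2 / 4"]
    by (simp add: algebra_simps power2_eq_square)
  then show ?thesis unfolding bessel_D_lower by (simp add: algebra_simps)
qed

lemma bessel_B_rec: "x * (bessel_B p x + bessel_B (Suc (Suc p)) x) = 2 * real (Suc p) * bessel_B (Suc p) x"
  using bessel_D_raise[of x p] bessel_D_lower[of x "Suc p"] by (simp add: algebra_simps)

lemma continuous_on_bessel_B [continuous_intros]:
  "continuous_on S g \<Longrightarrow> continuous_on S (\<lambda>x. bessel_B p (g x))"
proof -
  have "continuous_on UNIV (bessel_B p)"
    using DERIV_bessel_B by (intro DERIV_continuous_on) (blast intro: has_field_derivative_at_within)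
  then show "continuous_on S g \<Longrightarrow> continuous_on S (\<lambda>x. bessel_B p (g x))"
    using continuous_on_compose2 by blast
qed

lemma bessel_B_pos_near_0:
  obtains e where "e > 0" "\<And>x. 0 < x \<Longrightarrow> x < e \<Longrightarrow> bessel_B p x > 0"
proof -
  have "isCont (bessel_G p) 0" using DERIV_bessel_G DERIV_isCont by blast
  then have "(bessel_G p \<longlongrightarrow> bessel_G p 0) (at 0)" by (simp add: isCont_def)
  moreover have "bessel_G p 0 > 0" by (simp add: bessel_G_0)
  ultimately have "eventually (\<lambda>y. bessel_G p y > 0) (at 0)" by (simp add: order_tendstoD)
  then obtain d where d: "d > 0" "\<And>y. y \<noteq> 0 \<Longrightarrow> \<bar>y\<bar> < d \<Longrightarrow> bessel_G p y > 0"
    unfolding eventually_at by (auto simp: dist_real_def)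
  show thesis
  proof (rule that[of "min 1 d"])
    fix x :: real assume x: "0 < x" "x < min 1 d"
    have "x\<^sup>2 \<le> x" using x by (simp add: power2_eq_square mult_left_le)
    then have "bessel_G p (x\<^sup>2 / 4) > 0" using x by (intro d) auto
    then show "bessel_B p x > 0" using x by (simp add: bessel_B_def)
  qed (use d in auto)
qed

text \<open>With u = J_p(a r) and v = J_p(b r), the differentiated function is r (u v' - u' v), the
  weighted Wronskian of two solutions of Bessel's equation. Written with order p + 1 it has no
  singularity at r = 0, and the ladder relations give its derivative.\<close>

lemma bessel_lommel_deriv:
  "((\<lambda>r. r * (a * bessel_B (Suc p) (a * r) * bessel_B p (b * r) - b * bessel_B p (a * r) * bessel_B (Suc p) (b * r)))
    has_real_derivative (a\<^sup>2 - b\<^sup>2) * (r * bessel_B p (a * r) * bessel_B p (b * r))) (at r)"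
proof -
  have D: "((\<lambda>r. bessel_B q (c * r)) has_real_derivative bessel_D q (c * r) * c) (at r)" for q c
    by (rule DERIV_chain2[OF DERIV_bessel_B]) (auto intro!: derivative_eq_intros)
  let ?B = "bessel_B p" and ?C = "bessel_B (Suc p)" and ?B' = "bessel_D p" and ?C' = "bessel_D (Suc p)"
  have 1: "c * r * ?B' (c * r) = real p * ?B (c * r) - c * r * ?C (c * r)" for c
    by (rule bessel_D_lower)
  have 2: "c * r * ?C' (c * r) = c * r * ?B (c * r) - (real p + 1) * ?C (c * r)" for c
    using bessel_D_raise[of "c * r" p] by (simp add: add.commute)
  show ?thesis
    by (rule derivative_eq_intros D refl)+ (use 1[of a] 1[of b] 2[of a] 2[of b] in algebra)
qed

text \<open>The diagonal case a = b, where the Wronskian degenerates. The antiderivative is the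
  classical r^2 (J_p^2 - J_(p-1) J_(p+1)) / 2 with J_(p-1) eliminated by the three-term
  recurrence.\<close>

lemma bessel_norm_deriv:
  assumes "a \<noteq> 0"
  shows "((\<lambda>r. r\<^sup>2 * ((bessel_B p (a * r))\<^sup>2 + (bessel_B (Suc p) (a * r))\<^sup>2) / 2
      - real p / a * (r * (bessel_B p (a * r) * bessel_B (Suc p) (a * r))))
    has_real_derivative r * (bessel_B p (a * r))\<^sup>2) (at r)"
proof -
  have D: "((\<lambda>r. bessel_B q (a * r)) has_real_derivative bessel_D q (a * r) * a) (at r)" for q
    by (rule DERIV_chain2[OF DERIV_bessel_B]) (auto intro!: derivative_eq_intros)
  let ?B = "\<lambda>r. bessel_B p (a * r)" and ?C = "\<lambda>r. bessel_B (Suc p) (a * r)"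
  have 1: "a * r * bessel_D p (a * r) = real p * ?B r - a * r * ?C r" by (rule bessel_D_lower)
  have 2: "a * r * bessel_D (Suc p) (a * r) = a * r * ?B r - (real p + 1) * ?C r"
    using bessel_D_raise[of "a * r" p] by (simp add: add.commute)
  \<comment> \<open>Polynomial core of the computation: \<open>i\<close> plays 1 / a, while
    \<open>X\<close> and \<open>Y\<close> play a r times the derivatives of orders p and p + 1, so
    the last two premises are the ladder relations.\<close>
  have key: "r * (B * B + C * C) + r * (B * X + C * Y) - P * i * (B * C + X * C + B * Y) = r * (B * B)"
    if "a * i = 1" "X = P * B - a * r * C" "Y = a * r * B - (P + 1) * C" for i B C X Y P
  proof -
    have "B * C + X * C + B * Y = a * (r * (B * B - C * C))" unfolding that by (simp add: algebra_simps)
    then have "P * i * (B * C + X * C + B * Y) = P * (r * (B * B - C * C))" using that(1) by algebra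
    then show ?thesis unfolding that by (simp add: algebra_simps)
  qed
  have "((\<lambda>r. h * (r * r * (?B r * ?B r + ?C r * ?C r)) - real p * i * (r * (?B r * ?C r)))
    has_real_derivative r * (?B r * ?B r)) (at r)" if "a * i = 1" "2 * h = 1" for i h
  proof (rule DERIV_cong)
    show "((\<lambda>r. h * (r * r * (?B r * ?B r + ?C r * ?C r)) - real p * i * (r * (?B r * ?C r)))
      has_real_derivative (2 * h) * (r * (?B r * ?B r + ?C r * ?C r))
       + (2 * h) * (r * (?B r * (a * r * bessel_D p (a * r)) + ?C r * (a * r * bessel_D (Suc p) (a * r))))
       - real p * i * (?B r * ?C r + a * r * bessel_D p (a * r) * ?C r
          + ?B r * (a * r * bessel_D (Suc p) (a * r)))) (at r)"
      by (rule derivative_eq_intros D refl)+ (simp add: algebra_simps)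
  qed (use key[OF that(1) 1 2] that(2) in simp)
  from this[of "1 / a" "1 / 2"] assms
  have "((\<lambda>r. 1 / 2 * (r * r * (?B r * ?B r + ?C r * ?C r)) - real p * (1 / a) * (r * (?B r * ?C r)))
    has_real_derivative r * (?B r * ?B r)) (at r)" by simp
  then show ?thesis by (simp add: power2_eq_square)
qed

lemma bessel_lommel:
  assumes "bessel_B p a = 0"
  shows "((\<lambda>r. (a\<^sup>2 - b\<^sup>2) * (r * bessel_B p (a * r) * bessel_B p (b * r)))
    has_integral a * bessel_B (Suc p) a * bessel_B p b) {0..1}"
proof -
  let ?F = "\<lambda>r. r * (a * bessel_B (Suc p) (a * r) * bessel_B p (b * r)
    - b * bessel_B p (a * r) * bessel_B (Suc p) (b * r))"
  have "((\<lambda>r. (a\<^sup>2 - b\<^sup>2) * (r * bessel_B p (a * r) * bessel_B p (b * r))) has_integral ?F 1 - ?F 0) {0..1}"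
  proof (rule fundamental_theorem_of_calculus)
    show "(?F has_vector_derivative (a\<^sup>2 - b\<^sup>2) * (r * bessel_B p (a * r) * bessel_B p (b * r)))
        (at r within {0..1})" for r
      using has_field_derivative_at_within[OF bessel_lommel_deriv[of a p b r]]
      unfolding has_real_derivative_iff_has_vector_derivative .
  qed simp
  then show ?thesis using assms by simp
qed

lemma bessel_norm:
  assumes "bessel_B p a = 0" "a \<noteq> 0"
  shows "((\<lambda>r. r * (bessel_B p (a * r))\<^sup>2) has_integral (bessel_B (Suc p) a)\<^sup>2 / 2) {0..1}"
proof -
  let ?F = "\<lambda>r. r\<^sup>2 * ((bessel_B p (a * r))\<^sup>2 + (bessel_B (Suc p) (a * r))\<^sup>2) / 2
      - real p / a * (r * (bessel_B p (a * r) * bessel_B (Suc p) (a * r)))"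
  have "((\<lambda>r. r * (bessel_B p (a * r))\<^sup>2) has_integral ?F 1 - ?F 0) {0..1}"
  proof (rule fundamental_theorem_of_calculus)
    show "(?F has_vector_derivative r * (bessel_B p (a * r))\<^sup>2) (at r within {0..1})" for r
      using has_field_derivative_at_within[OF bessel_norm_deriv[OF assms(2), of p r]]
      unfolding has_real_derivative_iff_has_vector_derivative .
  qed simp
  then show ?thesis using assms by simp
qed

section \<open>Zeros of Bessel functions\<close>

text \<open>At a double zero \<open>a\<close> the integral of \<open>r B(a r)\<^sup>2\<close> over \<open>[0, 1]\<close> would vanish.\<close>

lemma bessel_B_simple_zero:
  assumes "a > 0" "bessel_B p a = 0"
  shows "bessel_B (Suc p) a \<noteq> 0"
proof
  assume "bessel_B (Suc p) a = 0"
  with bessel_norm[of p a] assms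
  have int: "((\<lambda>r. r * (bessel_B p (a * r))\<^sup>2) has_integral 0) (cbox 0 1)" by simp
  obtain e where e: "e > 0" "\<And>x. 0 < x \<Longrightarrow> x < e \<Longrightarrow> bessel_B p x > 0"
    using bessel_B_pos_near_0 by blast
  define r where "r = min 1 (e / (2 * a))"
  have r: "0 < r" "r \<le> 1" "a * r < e"
  proof -
    have "a * r \<le> a * (e / (2 * a))" unfolding r_def using assms by (intro mult_left_mono) auto
    then show "a * r < e" using assms e by simp
  qed (use assms e in \<open>auto simp: r_def\<close>)
  have "r * (bessel_B p (a * r))\<^sup>2 = 0"
    by (rule has_integral_0_cbox_imp_0[OF _ _ int])
      (use r in \<open>auto intro!: continuous_intros mult_nonneg_nonneg\<close>)
  with r e(2)[of "a * r"] assms show False by auto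
qed

lemma bessel_D_at_zero:
  assumes "a > 0" "bessel_B p a = 0"
  shows "bessel_D p a = - bessel_B (Suc p) a"
proof -
  have "a * (bessel_D p a + bessel_B (Suc p) a) = 0"
    using bessel_D_lower[of a p] assms by (simp add: algebra_simps)
  then show ?thesis using assms by simp
qed

text \<open>Infinitely many zeros would accumulate at some c. Positivity near 0 excludes c = 0;
  otherwise c is itself a zero, and its nonzero derivative isolates it.\<close>

lemma finite_bessel_B_zeros: "finite {x. 0 < x \<and> x \<le> b \<and> bessel_B p x = 0}" (is "finite ?Z")
proof (rule ccontr)
  assume "infinite ?Z"
  moreover have "?Z \<subseteq> {0..b}" by auto
  ultimately obtain c where c: "c \<in> {0..b}" "c islimpt ?Z"
    using Heine_Borel_imp_Bolzano_Weierstrass[OF compact_Icc] by blast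
  show False
  proof (cases "c = 0")
    case True
    obtain e where e: "e > 0" "\<And>x. 0 < x \<Longrightarrow> x < e \<Longrightarrow> bessel_B p x > 0"
      using bessel_B_pos_near_0 by blast
    from c(2) obtain y where "y \<in> ?Z" "dist y c < e"
      unfolding islimpt_approachable using e(1) by blast
    with e(2)[of y] True show False by (simp add: dist_real_def)
  next
    case False
    have "closed (bessel_B p -` {0})"
      by (rule closed_vimage) (auto intro: continuous_on_bessel_B[of UNIV "\<lambda>x. x"])
    moreover have "c islimpt (bessel_B p -` {0})" using c(2) by (rule islimpt_subset) auto
    ultimately have z: "bessel_B p c = 0" unfolding closed_limpt by auto
    have "bessel_D p c \<noteq> 0"
      using bessel_D_at_zero[of c p] bessel_B_simple_zero[of c p] False c z by auto
    moreover have "((\<lambda>y. (bessel_B p y - bessel_B p c) / (y - c)) \<longlongrightarrow> bessel_D p c) (at c)"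
      using DERIV_bessel_B has_field_derivative_iff by blast
    ultimately have "eventually (\<lambda>y. (bessel_B p y - bessel_B p c) / (y - c) \<noteq> 0) (at c)"
      using tendsto_imp_eventually_ne by blast
    then have "eventually (\<lambda>y. y \<notin> ?Z) (at c)"
      by (rule eventually_mono) (auto simp: z)
    then show False using c(2) by (simp add: islimpt_iff_eventually)
  qed
qed

text \<open>
  If the sign were constant beyond \<open>X\<close>, then \<open>x B'(x)\<close> would be decreasing there, since its
  derivative is \<open>- (x - p\<^sup>2 / x) B(x)\<close>. Once negative, it pushes \<open>B\<close> below \<open>- c ln x\<close>; if it never
  becomes negative, then \<open>B\<close> is bounded below and \<open>x B'(x)\<close> itself decreases linearly.
\<close>

lemma bessel_B_no_constant_sign:
  assumes X: "X \<ge> real p + 1" and pos: "\<And>x. x \<ge> X \<Longrightarrow> s * bessel_B p x > 0"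
  shows False
proof -
  define v where "v = (\<lambda>x. s * bessel_B p x)"
  \<comment> \<open>By \<open>bessel_D_lower\<close> this is x v'(x), in a form that can be
    differentiated once more.\<close>
  define D where "D = (\<lambda>x. s * (real p * bessel_B p x - x * bessel_B (Suc p) x))"
  have dv: "(v has_real_derivative D x / x) (at x)" if "x \<ge> X" for x
  proof -
    have "x \<noteq> 0" using that X by auto
    then have "bessel_D p x = (real p * bessel_B p x - x * bessel_B (Suc p) x) / x"
      using bessel_D_lower[of x p] by (simp add: field_simps)
    then show ?thesis
      unfolding v_def D_def using DERIV_cmult[OF DERIV_bessel_B[of p x], of s] by simp
  qed
  have dD: "(D has_real_derivative - (x - (real p)\<^sup>2 / x) * v x) (at x)" if "x \<ge> X" for x
  proof -
    have x: "x \<noteq> 0" using that X by auto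
    have 1: "bessel_D p x = (real p * bessel_B p x - x * bessel_B (Suc p) x) / x"
      using bessel_D_lower[of x p] x by (simp add: field_simps)
    have 2: "bessel_D (Suc p) x = (x * bessel_B p x - (real p + 1) * bessel_B (Suc p) x) / x"
      using bessel_D_raise[of x p] x by (simp add: field_simps)
    have "(D has_real_derivative s * (real p * bessel_D p x - (1 * bessel_B (Suc p) x + bessel_D (Suc p) x * x))) (at x)"
      unfolding D_def by (intro DERIV_cmult DERIV_diff DERIV_mult DERIV_ident DERIV_bessel_B)
    moreover have "s * (real p * bessel_D p x - (1 * bessel_B (Suc p) x + bessel_D (Suc p) x * x))
        = - (x - (real p)\<^sup>2 / x) * v x"
      unfolding 1 2 v_def using x by (simp add: field_simps power2_eq_square)
    ultimately show ?thesis by simp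
  qed
  have vpos: "v x > 0" if "x \<ge> X" for x using pos that by (simp add: v_def)
  \<comment> \<open>The threshold p + 1 is chosen for this: p^2 <= p x <= (x - 1) x.\<close>
  have q: "x - (real p)\<^sup>2 / x \<ge> 1" if "x \<ge> X" for x
  proof -
    have x: "x \<ge> real p + 1" "x > 0" using that X by auto
    have "(real p)\<^sup>2 \<le> real p * x" using x by (simp add: power2_eq_square mult_left_mono)
    also have "\<dots> \<le> (x - 1) * x" using x by (intro mult_right_mono) auto
    finally show ?thesis using x by (simp add: field_simps)
  qed
  have Dle: "D y \<le> D x - c * (y - x)" if "X \<le> x" "x \<le> y" "c \<ge> 0" "\<And>t. t \<ge> X \<Longrightarrow> c \<le> v t" for x y c
  proof -
    have "D y + c * y \<le> D x + c * x"
    proof (rule DERIV_nonpos_imp_nonincreasing[OF that(2)])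
      fix t assume t: "x \<le> t" "t \<le> y"
      then have "((\<lambda>x. D x + c * x) has_real_derivative - (t - (real p)\<^sup>2 / t) * v t + c) (at t)"
        using that by (auto intro!: derivative_eq_intros dD)
      moreover have "c * 1 \<le> v t * (t - (real p)\<^sup>2 / t)"
        using t that q[of t] vpos[of t] by (intro mult_mono) auto
      ultimately show "\<exists>z. ((\<lambda>x. D x + c * x) has_real_derivative z) (at t) \<and> z \<le> 0"
        by (intro exI conjI) (auto simp: algebra_simps)
    qed
    then show ?thesis by (simp add: algebra_simps)
  qed
  show False
  proof (cases "\<exists>x0\<ge>X. D x0 < 0")
    case True
    then obtain x0 where x0: "x0 \<ge> X" "D x0 < 0" by blast
    have x0p: "x0 > 0" using x0 X by auto
    \<comment> \<open>The point at which the upper bound v(x0) + D(x0) ln(y / x0) reaches 0.\<close>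
    define y where "y = x0 * exp (v x0 / - D x0)"
    have y: "y \<ge> x0" unfolding y_def using x0p x0 vpos[of x0] by (simp add: divide_nonneg_neg)
    have "v y - D x0 * ln y \<le> v x0 - D x0 * ln x0"
    proof (rule DERIV_nonpos_imp_nonincreasing[OF y])
      fix t assume t: "x0 \<le> t" "t \<le> y"
      have "((\<lambda>x. v x - D x0 * ln x) has_real_derivative D t / t - D x0 * (1 / t)) (at t)"
        using t x0 x0p by (auto intro!: derivative_eq_intros dv)
      moreover have "D t \<le> D x0" using Dle[of x0 t 0] t x0 vpos by (auto simp: less_imp_le)
      ultimately show "\<exists>z. ((\<lambda>x. v x - D x0 * ln x) has_real_derivative z) (at t) \<and> z \<le> 0"
        using t x0p by (intro exI conjI) (auto simp: diff_divide_distrib[symmetric] divide_nonpos_pos)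
    qed
    moreover have "ln y = ln x0 + v x0 / - D x0" unfolding y_def using x0p by (simp add: ln_mult)
    ultimately have "v y \<le> 0" using x0 by (simp add: field_simps zero_le_mult_iff)
    then show False using vpos[of y] y x0 by simp
  next
    case False
    have vmono: "v X \<le> v x" if "X \<le> x" for x
    proof (rule DERIV_nonneg_imp_nondecreasing[OF that])
      fix t assume "X \<le> t" "t \<le> x"
      then show "\<exists>z. (v has_real_derivative z) (at t) \<and> 0 \<le> z"
        using False X dv[of t] by (intro exI[of _ "D t / t"]) (auto simp: not_less)
    qed
    \<comment> \<open>The point at which the linear upper bound D(X) - v(X) (y - X) of
      \<open>D\<close> reaches -1.\<close>
    define y where "y = X + (D X + 1) / v X"
    have "D X \<ge> 0" using False by (auto simp: not_less)
    then have y: "y \<ge> X" using vpos[of X] by (simp add: y_def)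
    have "D y \<le> D X - v X * (y - X)" using Dle[of X y "v X"] y vmono vpos[of X] by auto
    also have "\<dots> = - 1" using vpos[of X] by (simp add: y_def)
    finally show False using False y by auto
  qed
qed

lemma bessel_B_constant_sign:
  assumes "a < x" "a < y" "\<And>t. a < t \<Longrightarrow> t \<le> max x y \<Longrightarrow> bessel_B p t \<noteq> 0"
  shows "bessel_B p x > 0 \<longleftrightarrow> bessel_B p y > 0"
proof -
  have *: "bessel_B p v > 0" if "a < u" "a < v" "u \<le> max x y" "v \<le> max x y" "bessel_B p u > 0" for u v
  proof (rule ccontr)
    assume "\<not> bessel_B p v > 0"
    then have le: "bessel_B p v \<le> 0" by simp
    have C: "continuous_on S (bessel_B p)" for S using continuous_on_bessel_B[of S "\<lambda>x. x"] by simp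
    have "\<exists>t. min u v \<le> t \<and> t \<le> max u v \<and> bessel_B p t = 0"
    proof (cases "u \<le> v")
      case True
      then show ?thesis using IVT2'[of "bessel_B p" v 0 u] le that C by auto
    next
      case False
      then show ?thesis using IVT'[of "bessel_B p" v 0 u] le that C by auto
    qed
    then obtain t where "min u v \<le> t" "t \<le> max u v" "bessel_B p t = 0" by blast
    then show False using assms(3)[of t] that by (auto simp: min_def max_def split: if_splits)
  qed
  show ?thesis using *[of x y] *[of y x] assms by auto
qed

lemma bessel_B_zeros_unbounded: "\<exists>x > a. bessel_B p x = 0"
proof (rule ccontr)
  assume "\<not> ?thesis"
  then have nz: "bessel_B p x \<noteq> 0" if "x > a" for x using that by auto
  define X where "X = max (a + 1) (real p + 1)"
  define s where "s = sgn (bessel_B p X)"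
  have "s * bessel_B p x > 0" if "x \<ge> X" for x
  proof -
    have "bessel_B p x > 0 \<longleftrightarrow> bessel_B p X > 0"
      by (rule bessel_B_constant_sign[of a]) (use that nz in \<open>auto simp: X_def\<close>)
    moreover have "bessel_B p x \<noteq> 0" "bessel_B p X \<noteq> 0" using that nz by (auto simp: X_def)
    ultimately show ?thesis by (auto simp: s_def sgn_if)
  qed
  then show False using bessel_B_no_constant_sign[of p X s] by (simp add: X_def)
qed

text \<open>The induction carries the sign just to the right of the n-th zero \<open>a\<close> (with
  a = 0 for n = 0). That sign persists up to the next zero, where simplicity makes it flip; this
  yields both the existence of every zero and the factor (-1)^n.\<close>

lemma bessel_B_nth_zero_aux:
  "\<exists>a e. 0 \<le> a \<and> a < e \<and> (\<forall>x. a < x \<and> x < e \<longrightarrow> (- 1) ^ n * bessel_B p x > 0)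
    \<and> card {x. 0 < x \<and> x \<le> a \<and> bessel_B p x = 0} = n
    \<and> (n > 0 \<longrightarrow> 0 < a \<and> bessel_B p a = 0 \<and> (- 1) ^ n * bessel_B (Suc p) a < 0)"
proof (induction n)
  case 0
  obtain e where "e > 0" "\<And>x. 0 < x \<Longrightarrow> x < e \<Longrightarrow> bessel_B p x > 0"
    using bessel_B_pos_near_0 by blast
  moreover have "{x. 0 < x \<and> x \<le> 0 \<and> bessel_B p x = 0} = {}" by auto
  then have "card {x. 0 < x \<and> x \<le> 0 \<and> bessel_B p x = 0} = 0" by (simp only: card.empty)
  ultimately show ?case by (intro exI[of _ 0] exI[of _ e] conjI) simp_all
next
  case (Suc n)
  then obtain a e where a: "0 \<le> a" "a < e" "\<And>x. a < x \<Longrightarrow> x < e \<Longrightarrow> (- 1) ^ n * bessel_B p x > 0"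
    "card {x. 0 < x \<and> x \<le> a \<and> bessel_B p x = 0} = n" by blast
  obtain y where y: "y > a" "bessel_B p y = 0" using bessel_B_zeros_unbounded by blast
  define N where "N = {x. a < x \<and> x \<le> y \<and> bessel_B p x = 0}"
  have N: "finite N" "N \<noteq> {}"
  proof -
    have "N \<subseteq> {x. 0 < x \<and> x \<le> y \<and> bessel_B p x = 0}" using a(1) by (auto simp: N_def)
    then show "finite N" using finite_bessel_B_zeros by (rule finite_subset)
    show "N \<noteq> {}" using y by (auto simp: N_def)
  qed
  define b where "b = Min N"
  have "b \<in> N" unfolding b_def using N by (rule Min_in)
  then have b: "a < b" "bessel_B p b = 0" by (auto simp: N_def)
  have b_min: "bessel_B p x \<noteq> 0" if "a < x" "x < b" for x
  proof
    assume "bessel_B p x = 0"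
    then have "x \<in> N" using that \<open>b \<in> N\<close> by (auto simp: N_def)
    then show False using Min_le[OF N(1), of x] that by (simp add: b_def)
  qed
  have left: "(- 1) ^ n * bessel_B p x > 0" if "a < x" "x < b" for x
  proof -
    \<comment> \<open>A point not beyond \<open>x\<close> that also lies in the interval where the
      induction hypothesis knows the sign.\<close>
    define w where "w = (a + min x e) / 2"
    have w: "a < w" "w < e" "w \<le> x" unfolding w_def using that a by (auto simp: min_def)
    have "bessel_B p x > 0 \<longleftrightarrow> bessel_B p w > 0"
      by (rule bessel_B_constant_sign[of a]) (use that w b_min in auto)
    moreover have "(- 1) ^ n * bessel_B p w > 0" using a w by blast
    moreover have "bessel_B p x \<noteq> 0" using b_min that by blast
    ultimately show ?thesis by (cases "even n") auto
  qed
  have D: "((\<lambda>x. (- 1) ^ n * bessel_B p x) has_real_derivative (- 1) ^ n * bessel_D p b) (at b)"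
    by (rule DERIV_cmult) (rule DERIV_bessel_B)
  have "bessel_D p b \<noteq> 0"
    using bessel_D_at_zero[of b p] bessel_B_simple_zero[of b p] a b by simp
  \<comment> \<open>A positive slope at the zero \<open>b\<close> would give negative values just to
    its left, against \<open>left\<close>.\<close>
  moreover have "\<not> (- 1) ^ n * bessel_D p b > 0"
  proof
    assume "(- 1) ^ n * bessel_D p b > 0"
    from DERIV_pos_inc_left[OF D this] obtain d
      where d: "d > 0" "\<And>h. 0 < h \<Longrightarrow> h < d \<Longrightarrow> (- 1) ^ n * bessel_B p (b - h) < 0" using b by auto
    define h where "h = min d (b - a) / 2"
    have "0 < h" "h < d" "h < b - a" using d b by (auto simp: h_def min_def)
    then show False using d(2)[of h] left[of "b - h"] by auto
  qed
  ultimately have neg: "(- 1) ^ n * bessel_D p b < 0" by (auto simp: not_less le_less)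
  from DERIV_neg_dec_right[OF D this] obtain d
    where d: "d > 0" "\<And>h. 0 < h \<Longrightarrow> h < d \<Longrightarrow> (- 1) ^ n * bessel_B p (b + h) < 0" using b by auto
  have "{x. 0 < x \<and> x \<le> b \<and> bessel_B p x = 0} = insert b {x. 0 < x \<and> x \<le> a \<and> bessel_B p x = 0}"
    (is "?L = ?R")
  proof (rule set_eqI)
    fix x
    consider "x \<le> a" | "a < x" "x < b" | "x = b" | "x > b" by linarith
    then show "x \<in> ?L \<longleftrightarrow> x \<in> ?R" using a(1) b b_min[of x] by cases auto
  qed
  then have "card {x. 0 < x \<and> x \<le> b \<and> bessel_B p x = 0} = Suc n"
    using a b finite_bessel_B_zeros[of a p] by simp
  moreover have "(- 1) ^ Suc n * bessel_B p x > 0" if "b < x" "x < b + d" for x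
    using d(2)[of "x - b"] that by simp
  moreover have "(- 1) ^ Suc n * bessel_B (Suc p) b < 0"
    using neg bessel_D_at_zero[of b p] a b by simp
  ultimately show ?case using a(1) b d(1) by (intro exI[of _ b] exI[of _ "b + d"] conjI allI impI) simp_all
qed

text \<open>Uniqueness holds because the number of positive zeros up to a point jumps at every zero,
  so two zeros with the same count coincide. This is what makes the definite description in
  \<open>bessel_zero\<close> meaningful.\<close>

lemma bessel_B_nth_zero:
  assumes "n \<ge> 1"
  obtains z where "0 < z" "bessel_B p z = 0" "(- 1) ^ n * bessel_B (Suc p) z < 0"
    "card {x. 0 < x \<and> x \<le> z \<and> bessel_B p x = 0} = n"
    "\<And>y. 0 < y \<Longrightarrow> bessel_B p y = 0 \<Longrightarrow> card {x. 0 < x \<and> x \<le> y \<and> bessel_B p x = 0} = n \<Longrightarrow> y = z"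
proof -
  obtain z where z: "0 < z" "bessel_B p z = 0" "(- 1) ^ n * bessel_B (Suc p) z < 0"
    "card {x. 0 < x \<and> x \<le> z \<and> bessel_B p x = 0} = n"
    using bessel_B_nth_zero_aux[of n p] assms by auto
  have less: "card {x. 0 < x \<and> x \<le> u \<and> bessel_B p x = 0} < card {x. 0 < x \<and> x \<le> v \<and> bessel_B p x = 0}"
    if "u < v" "0 < v" "bessel_B p v = 0" for u v
  proof (rule psubset_card_mono[OF finite_bessel_B_zeros], rule psubsetI)
    show "{x. 0 < x \<and> x \<le> u \<and> bessel_B p x = 0} \<subseteq> {x. 0 < x \<and> x \<le> v \<and> bessel_B p x = 0}"
      using that by auto
    have "v \<in> {x. 0 < x \<and> x \<le> v \<and> bessel_B p x = 0}" "v \<notin> {x. 0 < x \<and> x \<le> u \<and> bessel_B p x = 0}"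
      using that by auto
    then show "{x. 0 < x \<and> x \<le> u \<and> bessel_B p x = 0} \<noteq> {x. 0 < x \<and> x \<le> v \<and> bessel_B p x = 0}" by blast
  qed
  show thesis
  proof (rule that[OF z])
    fix y assume "0 < y" "bessel_B p y = 0" "card {x. 0 < x \<and> x \<le> y \<and> bessel_B p x = 0} = n"
    then show "y = z" using less[of y z] less[of z y] z by (cases y z rule: linorder_cases) auto
  qed
qed

section \<open>Bessel functions of integer order\<close>

lemma bessel_J_nonneg: "bessel_J (int p) x = bessel_B p x"
proof -
  have "(- 1) ^ k / fact k * rGamma (of_int (int p) + of_nat k + 1) * (x / 2) powi (2 * int k + int p)
      = (- 1) ^ k / (fact k * fact (k + p)) * (x / 2) ^ (2 * k + p)" for k
  proof -
    have "of_int (int p) + of_nat k + 1 = 1 + (of_nat (k + p) :: real)" by simp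
    then have "rGamma (of_int (int p) + of_nat k + 1) = 1 / (fact (k + p) :: real)"
      by (simp only: rGamma_inverse_Gamma Gamma_fact) (simp add: divide_inverse)
    moreover have "2 * int k + int p = int (2 * k + p)" by simp
    then have "(x / 2) powi (2 * int k + int p) = (x / 2) ^ (2 * k + p)" by (simp only: power_int_of_nat)
    ultimately show ?thesis by simp
  qed
  then show ?thesis unfolding bessel_J_def using bessel_B_sums[of p x] by (simp only: sums_iff)
qed

text \<open>The first p terms vanish because Gamma has poles at the nonpositive integers. After a
  shift by p, the factorial and the Gamma factor exchange roles, and the shift of (-1)^k supplies
  the sign.\<close>

lemma bessel_J_neg: "bessel_J (- int p) x = (- 1) ^ p * bessel_B p x"
proof -
  define t where "t = (\<lambda>k. (- 1) ^ k / fact k * rGamma (of_int (- int p) + of_nat k + 1) *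
    (x / 2) powi (2 * int k + - int p))"
  have "t k = 0" if "k < p" for k
  proof -
    have "of_int (- int p) + of_nat k + 1 = - (of_nat (p - k - 1) :: real)" using that by simp
    also have "\<dots> \<in> \<int>\<^sub>\<le>\<^sub>0" unfolding nonpos_Ints_altdef by simp
    finally have "rGamma (of_int (- int p) + of_nat k + 1) = (0 :: real)"
      using rGamma_eq_zero_iff by blast
    then show ?thesis unfolding t_def by (simp only: mult_zero_left mult_zero_right)
  qed
  moreover have "t (k + p) = (- 1) ^ p * ((- 1) ^ k / (fact k * fact (k + p)) * (x / 2) ^ (2 * k + p))" for k
  proof -
    have "of_int (- int p) + of_nat (k + p) + 1 = 1 + (of_nat k :: real)" by simp
    then have "rGamma (of_int (- int p) + of_nat (k + p) + 1) = 1 / (fact k :: real)"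
      by (simp only: rGamma_inverse_Gamma Gamma_fact) (simp add: divide_inverse)
    moreover have "2 * int (k + p) + - int p = int (2 * k + p)" by simp
    then have "(x / 2) powi (2 * int (k + p) + - int p) = (x / 2) ^ (2 * k + p)" by (simp only: power_int_of_nat)
    ultimately show ?thesis unfolding t_def by (simp add: power_add mult_ac)
  qed
  then have "(\<lambda>k. t (k + p)) sums ((- 1) ^ p * bessel_B p x)"
    using sums_mult[OF bessel_B_sums[of p x], of "(- 1) ^ p"] by simp
  ultimately have "t sums ((- 1) ^ p * bessel_B p x)"
    using sums_iff_shift[of t p "(- 1) ^ p * bessel_B p x"] by simp
  then show ?thesis unfolding bessel_J_def t_def by (simp add: sums_iff)
qed

text \<open>The sign epsilon_m in \<open>c_coeff\<close>, and at the same time the ratio of J_m to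
  J_|m|, through which all integer orders reduce to natural ones.\<close>

definition order_sign :: "int \<Rightarrow> real" where
  "order_sign m = (if 0 \<le> m then 1 else (- 1) powi m)"

lemma order_sign_of_nat [simp]: "order_sign (int p) = 1"
  by (simp add: order_sign_def)

lemma order_sign_minus_of_nat [simp]: "order_sign (- int p) = (- 1) ^ p"
proof (cases "p = 0")
  case False
  then show ?thesis
    by (simp add: order_sign_def power_int_minus power_inverse[symmetric] del: power_inverse)
qed (simp add: order_sign_def)

lemma order_sign_cases: "order_sign m = 1 \<or> order_sign m = - 1"
proof (cases m rule: int_cases2)
  case (nonpos p)
  then show ?thesis by (cases "even p") simp_all
qed simp

lemma bessel_J_eq_bessel_B: "bessel_J m x = order_sign m * bessel_B (nat \<bar>m\<bar>) x"
proof (cases m rule: int_cases2)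
  case (nonneg p)
  then show ?thesis by (simp add: bessel_J_nonneg)
next
  case (nonpos p)
  then show ?thesis by (simp add: bessel_J_neg)
qed

lemma bessel_zero_properties:
  assumes "n \<ge> 1"
  shows "bessel_zero m n > 0" "bessel_B (nat \<bar>m\<bar>) (bessel_zero m n) = 0"
    "(- 1) ^ n * bessel_B (Suc (nat \<bar>m\<bar>)) (bessel_zero m n) < 0"
proof -
  let ?p = "nat \<bar>m\<bar>"
  have J: "bessel_J m x = 0 \<longleftrightarrow> bessel_B ?p x = 0" for x
  proof -
    have "order_sign m \<noteq> 0" using order_sign_cases[of m] by auto
    then show ?thesis by (simp add: bessel_J_eq_bessel_B)
  qed
  obtain z where z: "0 < z" "bessel_B ?p z = 0" "(- 1) ^ n * bessel_B (Suc ?p) z < 0"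
    "card {x. 0 < x \<and> x \<le> z \<and> bessel_B ?p x = 0} = n"
    "\<And>y. 0 < y \<Longrightarrow> bessel_B ?p y = 0 \<Longrightarrow> card {x. 0 < x \<and> x \<le> y \<and> bessel_B ?p x = 0} = n \<Longrightarrow> y = z"
    using bessel_B_nth_zero[OF assms, of ?p] by blast
  have eq: "bessel_zero m n = z"
    unfolding bessel_zero_def J by (rule the_equality) (use z in blast)+
  show "bessel_zero m n > 0" "bessel_B ?p (bessel_zero m n) = 0"
    "(- 1) ^ n * bessel_B (Suc ?p) (bessel_zero m n) < 0"
    unfolding eq by (rule z)+
qed

text \<open>For negative \<open>m\<close> the order |m + 1| is |m| - 1 rather than |m| + 1. At a
  zero of J_|m| the three-term recurrence makes these two neighbours opposite, so the moduli
  agree.\<close>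

lemma abs_bessel_J_next:
  assumes "n \<ge> 1"
  shows "\<bar>bessel_J (m + 1) (bessel_zero m n)\<bar> = (- 1) ^ Suc n * bessel_B (Suc (nat \<bar>m\<bar>)) (bessel_zero m n)"
proof -
  let ?p = "nat \<bar>m\<bar>" and ?z = "bessel_zero m n"
  have J: "\<bar>bessel_J k x\<bar> = \<bar>bessel_B (nat \<bar>k\<bar>) x\<bar>" for k x
    using order_sign_cases[of k] by (auto simp: bessel_J_eq_bessel_B abs_mult)
  have "\<bar>bessel_J (m + 1) ?z\<bar> = \<bar>bessel_B (Suc ?p) ?z\<bar>"
  proof (cases "m \<ge> 0")
    case True
    then have "nat \<bar>m + 1\<bar> = Suc ?p" by simp
    then show ?thesis by (simp only: J)
  next
    case False
    then obtain q where q: "?p = Suc q" using not0_implies_Suc[of ?p] by auto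
    then have "nat \<bar>m + 1\<bar> = q" using False by simp
    moreover have "bessel_B q ?z = - bessel_B (Suc (Suc q)) ?z"
      using bessel_B_rec[of ?z q] bessel_zero_properties[OF assms, of m] q by simp
    ultimately show ?thesis by (simp only: J q abs_minus_cancel)
  qed
  then show ?thesis using bessel_zero_properties(3)[OF assms, of m] by (cases "even n") auto
qed

lemma order_sign_mult_self: "order_sign m * order_sign m = 1"
  using order_sign_cases[of m] by auto

text \<open>Lommel's integral gives the case of distinct arguments; the norm integral gives the case
  t = z, which matches the limiting value built into \<open>bessel_quot\<close>.\<close>

lemma bessel_quot_integral:
  fixes m :: int
  assumes "n \<ge> 1" and t: "t \<ge> 0"
  defines "z \<equiv> bessel_zero m n"
  shows "((\<lambda>r. r * bessel_J m (z * r) * bessel_J m (t * r)) has_integral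
     (- 1) ^ n * order_sign m * z * \<bar>bessel_J (m + 1) z\<bar> * bessel_quot m n t) {0..1}"
proof -
  define B where "B = bessel_B (nat \<bar>m\<bar>)"
  define C where "C = bessel_B (Suc (nat \<bar>m\<bar>)) z"
  have z: "z > 0" "B z = 0" using bessel_zero_properties[OF assms(1), of m] by (auto simp: z_def B_def)
  \<comment> \<open>The factor (-1)^n undoes the absolute value in the normalisation of
    \<open>Psi\<close>.\<close>
  have C: "(- 1) ^ n * \<bar>bessel_J (m + 1) z\<bar> = - C"
    unfolding z_def C_def abs_bessel_J_next[OF assms(1)] by (cases "even n") auto
  have J: "bessel_J m = (\<lambda>x. order_sign m * B x)" by (rule ext) (simp add: bessel_J_eq_bessel_B B_def)
  have JJ: "r * bessel_J m (z * r) * bessel_J m (t * r) = r * B (z * r) * B (t * r)" for r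
  proof -
    have "r * bessel_J m (z * r) * bessel_J m (t * r) = (order_sign m * order_sign m) * (r * B (z * r) * B (t * r))"
      unfolding J by (simp only: mult_ac)
    then show ?thesis by (simp only: order_sign_mult_self mult_1_left)
  qed
  have "((\<lambda>r. r * B (z * r) * B (t * r)) has_integral - C * (z * (order_sign m * bessel_quot m n t))) {0..1}"
  proof (cases "t = z")
    case True
    have "deriv (bessel_J m) z = order_sign m * bessel_D (nat \<bar>m\<bar>) z"
      unfolding J B_def by (intro DERIV_imp_deriv DERIV_cmult DERIV_bessel_B)
    also have "bessel_D (nat \<bar>m\<bar>) z = - C" unfolding C_def
      by (rule bessel_D_at_zero) (use z B_def in auto)
    finally have "bessel_quot m n t = order_sign m * (- C) / (2 * z)"
      using True by (simp add: bessel_quot_def z_def)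
    then have "z * (order_sign m * bessel_quot m n t) = (order_sign m * order_sign m) * (- C) / 2"
      using z by simp
    then have val: "- C * (z * (order_sign m * bessel_quot m n t)) = C\<^sup>2 / 2"
      by (simp add: order_sign_mult_self power2_eq_square)
    show ?thesis unfolding val using bessel_norm[of "nat \<bar>m\<bar>" z] z True
      by (simp add: B_def C_def power2_eq_square mult.assoc)
  next
    case False
    then have ne: "z\<^sup>2 - t\<^sup>2 \<noteq> 0" using z t by (simp add: power2_eq_iff)
    have "((\<lambda>r. inverse (z\<^sup>2 - t\<^sup>2) * ((z\<^sup>2 - t\<^sup>2) * (r * B (z * r) * B (t * r))))
        has_integral inverse (z\<^sup>2 - t\<^sup>2) * (z * C * B t)) {0..1}"
      using bessel_lommel[of "nat \<bar>m\<bar>" z t] z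
      by (intro has_integral_mult_right) (simp add: B_def C_def)
    moreover have "bessel_quot m n t = order_sign m * B t / (t\<^sup>2 - z\<^sup>2)"
      using False by (simp add: bessel_quot_def z_def[symmetric] J)
    then have "order_sign m * bessel_quot m n t = (order_sign m * order_sign m) * (B t / (t\<^sup>2 - z\<^sup>2))" by simp
    then have "order_sign m * bessel_quot m n t = B t / (t\<^sup>2 - z\<^sup>2)" by (simp add: order_sign_mult_self)
    then have "- C * (z * (order_sign m * bessel_quot m n t)) = inverse (z\<^sup>2 - t\<^sup>2) * (z * C * B t)"
      using ne by (simp add: field_simps)
    ultimately show ?thesis using ne by (simp add: mult.assoc[symmetric])
  qed
  moreover have "(- 1) ^ n * order_sign m * z * \<bar>bessel_J (m + 1) z\<bar> * bessel_quot m n t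
      = ((- 1) ^ n * \<bar>bessel_J (m + 1) z\<bar>) * (z * (order_sign m * bessel_quot m n t))"
    by (simp only: mult_ac)
  ultimately show ?thesis by (simp only: JJ C)
qed

section \<open>Bessel's integral representation of J_m\<close>

lemma has_integral_exp_int:
  "((\<lambda>\<theta>. exp (\<i> * of_int k * of_real \<theta>)) has_integral (if k = 0 then of_real (2 * pi) else 0)) {0..2 * pi}"
proof (cases "k = 0")
  case True
  then show ?thesis using has_integral_const_real[of "1 :: complex" 0 "2 * pi"] by (simp add: scaleR_conv_of_real)
next
  case False
  let ?F = "\<lambda>\<theta>::real. exp (\<i> * of_int k * of_real \<theta>) / (\<i> * of_int k)"
  have "((\<lambda>\<theta>. exp (\<i> * of_int k * of_real \<theta>)) has_integral ?F (2 * pi) - ?F 0) {0..2 * pi}"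
  proof (rule fundamental_theorem_of_calculus)
    fix \<theta> :: real
    have "((\<lambda>z. exp (\<i> * of_int k * z) / (\<i> * of_int k)) has_field_derivative exp (\<i> * of_int k * of_real \<theta>)) (at (of_real \<theta>))"
      using False by (auto intro!: derivative_eq_intros)
    then show "(?F has_vector_derivative exp (\<i> * of_int k * of_real \<theta>)) (at \<theta> within {0..2 * pi})"
      by (rule has_vector_derivative_real_field)
  qed simp
  moreover have "exp (\<i> * of_int k * of_real (2 * pi)) = 1"
    using exp_integer_2pi[of "of_int k"] by (simp add: mult_ac)
  ultimately show ?thesis using False by simp
qed

text \<open>This is 2^n times the m-th Fourier coefficient of cos^n: the binomial coefficient of (n
  + m) / 2 if that is an integer from 0 to n, and 0 otherwise. The sum has at most one nonzero term;
  it comes straight from the binomial expansion and settles parity and range by itself.\<close>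

definition cos_weight :: "int \<Rightarrow> nat \<Rightarrow> nat" where
  "cos_weight m n = (\<Sum>j\<le>n. if 2 * int j = int n + m then n choose j else 0)"

lemma cos_power_fourier:
  "((\<lambda>\<theta>. of_real (cos (\<theta> - \<phi>) ^ n) * exp (- (\<i> * of_int m * of_real \<theta>))) has_integral
     2 * pi * exp (- (\<i> * of_int m * of_real \<phi>)) * of_nat (cos_weight m n) / 2 ^ n) {0..2 * pi}"
proof -
  let ?c = "\<lambda>j. of_nat (n choose j) / 2 ^ n * exp (\<i> * of_int (int n - 2 * int j) * of_real \<phi>) :: complex"
  have eq: "of_real (cos (\<theta> - \<phi>) ^ n) * exp (- (\<i> * of_int m * of_real \<theta>))
      = (\<Sum>j\<le>n. ?c j * exp (\<i> * of_int (2 * int j - int n - m) * of_real \<theta>))" for \<theta>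
  proof -
    let ?u = "of_real (\<theta> - \<phi>) :: complex"
    have "of_real (cos (\<theta> - \<phi>) ^ n) = ((exp (\<i> * ?u) + exp (- (\<i> * ?u))) / 2) ^ n"
      by (simp add: cos_of_real[symmetric] cos_exp_eq)
    also have "\<dots> = (\<Sum>j\<le>n. of_nat (n choose j) * exp (\<i> * ?u) ^ j * exp (- (\<i> * ?u)) ^ (n - j)) / 2 ^ n"
      by (simp add: power_divide binomial_ring)
    also have "\<dots> = (\<Sum>j\<le>n. of_nat (n choose j) / 2 ^ n * exp (\<i> * of_int (2 * int j - int n) * ?u))"
      unfolding sum_divide_distrib
    proof (intro sum.cong refl)
      fix j assume "j \<in> {..n}"
      then have j: "j \<le> n" by simp
      have "exp (\<i> * ?u) ^ j * exp (- (\<i> * ?u)) ^ (n - j) = exp (of_nat j * (\<i> * ?u) + of_nat (n - j) * (- (\<i> * ?u)))"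
        by (simp only: exp_of_nat_mult exp_add)
      also have "of_nat j * (\<i> * ?u) + of_nat (n - j) * (- (\<i> * ?u)) = \<i> * of_int (2 * int j - int n) * ?u"
        using j by (simp add: of_nat_diff algebra_simps)
      finally show "of_nat (n choose j) * exp (\<i> * ?u) ^ j * exp (- (\<i> * ?u)) ^ (n - j) / 2 ^ n
          = of_nat (n choose j) / 2 ^ n * exp (\<i> * of_int (2 * int j - int n) * ?u)"
        by (simp add: mult.assoc)
    qed
    finally show ?thesis
      by (simp add: sum_distrib_right mult.assoc exp_add[symmetric]) (simp add: algebra_simps)
  qed
  have "((\<lambda>\<theta>. \<Sum>j\<le>n. ?c j * exp (\<i> * of_int (2 * int j - int n - m) * of_real \<theta>)) has_integral
     (\<Sum>j\<le>n. ?c j * (if 2 * int j - int n - m = 0 then of_real (2 * pi) else 0))) {0..2 * pi}"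
    by (intro has_integral_sum has_integral_mult_right has_integral_exp_int) simp
  moreover have "(\<Sum>j\<le>n. ?c j * (if 2 * int j - int n - m = 0 then of_real (2 * pi) else 0))
      = (\<Sum>j\<le>n. 2 * pi * exp (- (\<i> * of_int m * of_real \<phi>)) / 2 ^ n *
          of_nat (if 2 * int j = int n + m then n choose j else 0))"
  proof (intro sum.cong refl)
    fix j
    show "?c j * (if 2 * int j - int n - m = 0 then of_real (2 * pi) else 0) =
      2 * pi * exp (- (\<i> * of_int m * of_real \<phi>)) / 2 ^ n * of_nat (if 2 * int j = int n + m then n choose j else 0)"
    proof (cases "2 * int j = int n + m")
      case True
      then have "int n - 2 * int j = - m" by simp
      then show ?thesis using True by (simp only:) simp
    next
      case False
      then have "2 * int j - int n - m \<noteq> 0" by simp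
      then show ?thesis using False by (simp only: if_False) simp
    qed
  qed
  moreover have "\<dots> = 2 * pi * exp (- (\<i> * of_int m * of_real \<phi>)) * of_nat (cos_weight m n) / 2 ^ n"
    unfolding cos_weight_def sum_distrib_left[symmetric] of_nat_sum[symmetric] by simp
  ultimately show ?thesis unfolding eq by simp
qed

text \<open>The powers n = 2 k + |m| are those that contribute. The index hit is k + |m| or k,
  according to the sign of \<open>m\<close>, and symmetry of the binomial coefficient merges the two
  cases.\<close>

lemma cos_weight_eq: "cos_weight m (2 * k + nat \<bar>m\<bar>) = (2 * k + nat \<bar>m\<bar>) choose k"
proof -
  let ?n = "2 * k + nat \<bar>m\<bar>" and ?j = "if m \<ge> 0 then k + nat \<bar>m\<bar> else k"
  have "cos_weight m ?n = (\<Sum>j\<le>?n. if j = ?j then ?n choose j else 0)"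
    unfolding cos_weight_def by (intro sum.cong refl) auto
  also have "\<dots> = ?n choose ?j" by (subst sum.delta) auto
  also have "\<dots> = ?n choose k" using binomial_symmetric[of k ?n] by (auto simp: mult_2)
  finally show ?thesis .
qed

lemma cos_weight_eq_0:
  assumes "n \<notin> range (\<lambda>k. 2 * k + nat \<bar>m\<bar>)"
  shows "cos_weight m n = 0"
proof -
  have "2 * int j \<noteq> int n + m" if "j \<le> n" for j
  proof
    assume *: "2 * int j = int n + m"
    have "n = 2 * (if m \<ge> 0 then n - j else j) + nat \<bar>m\<bar>" using * that by auto
    then show False using assms by blast
  qed
  then show ?thesis unfolding cos_weight_def by (intro sum.neutral) auto
qed

lemma i_powi_order_sign: "\<i> powi m * of_real (order_sign m) = \<i> ^ nat \<bar>m\<bar>"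
proof (cases m rule: int_cases2)
  case (nonneg p)
  then show ?thesis by simp
next
  case (nonpos p)
  have "\<i> powi (- int p) = inverse \<i> ^ p"
    by (simp only: power_int_minus power_int_of_nat power_inverse)
  then have "\<i> powi m * of_real (order_sign m) = (inverse \<i> * (- 1)) ^ p"
    unfolding nonpos order_sign_minus_of_nat power_mult_distrib by simp
  then show ?thesis using nonpos by simp
qed

text \<open>The exponential series in rho cos(theta - phi) converges uniformly in theta, so it may
  be integrated term by term. The surviving terms n = 2 k + |m| reproduce the power series of J_|m|,
  and \<open>i_powi_order_sign\<close> restores the sign of \<open>m\<close>.\<close>

lemma bessel_J_angular:
  "((\<lambda>\<theta>. exp (\<i> * of_real (\<rho> * cos (\<theta> - \<phi>))) * exp (- (\<i> * of_int m * of_real \<theta>))) has_integral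
    2 * pi * \<i> powi m * exp (- (\<i> * of_int m * of_real \<phi>)) * of_real (bessel_J m \<rho>)) {0..2 * pi}"
proof -
  let ?p = "nat \<bar>m\<bar>"
  let ?e = "\<lambda>\<theta>::real. exp (- (\<i> * of_int m * of_real \<theta>))"
  define t where "t = (\<lambda>n \<theta>. (\<i> * of_real \<rho>) ^ n / fact n * (of_real (cos (\<theta> - \<phi>) ^ n) * ?e \<theta>))"
  define I where "I = (\<lambda>n. (\<i> * of_real \<rho>) ^ n / fact n * (2 * pi * ?e \<phi> * of_nat (cos_weight m n) / 2 ^ n))"
  have t_int: "(t n has_integral I n) {0..2 * pi}" for n
    unfolding t_def I_def by (intro has_integral_mult_right cos_power_fourier)
  have t_sums: "(\<lambda>n. t n \<theta>) sums (exp (\<i> * of_real (\<rho> * cos (\<theta> - \<phi>))) * ?e \<theta>)" for \<theta>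
  proof -
    have "t n \<theta> = (\<i> * of_real (\<rho> * cos (\<theta> - \<phi>))) ^ n /\<^sub>R fact n * ?e \<theta>" for n
      by (simp add: t_def power_mult_distrib scaleR_conv_of_real field_simps)
    then show ?thesis using sums_mult2[OF exp_converges] by (simp only:)
  qed
  have bound: "norm (t n \<theta>) \<le> \<bar>\<rho>\<bar> ^ n / fact n" for n \<theta>
  proof -
    have "\<bar>cos (\<theta> - \<phi>)\<bar> ^ n \<le> 1 ^ n" by (intro power_mono) auto
    then have "\<bar>\<rho>\<bar> ^ n / fact n * \<bar>cos (\<theta> - \<phi>)\<bar> ^ n \<le> \<bar>\<rho>\<bar> ^ n / fact n * 1"
      by (intro mult_left_mono) auto
    then show ?thesis by (simp add: t_def norm_mult norm_divide norm_power power_abs)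
  qed
  have "summable (\<lambda>n. \<bar>\<rho>\<bar> ^ n / fact n)" using summable_exp[of "\<bar>\<rho>\<bar>"] by (simp add: field_simps)
  then have "uniform_limit {0..2 * pi} (\<lambda>n \<theta>. \<Sum>i<n. t i \<theta>) (\<lambda>\<theta>. \<Sum>i. t i \<theta>) sequentially"
    using bound by (intro Weierstrass_m_test) auto
  then have lim: "uniform_limit {0..2 * pi} (\<lambda>n \<theta>. \<Sum>i<n. t i \<theta>)
      (\<lambda>\<theta>. exp (\<i> * of_real (\<rho> * cos (\<theta> - \<phi>))) * ?e \<theta>) sequentially"
    using t_sums by (simp add: sums_iff)
  have cont: "continuous_on {0..2 * pi} (\<lambda>\<theta>. \<Sum>i<n. t i \<theta>)" for n
    unfolding t_def by (intro continuous_intros)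
  obtain S J where SJ: "\<And>n. ((\<lambda>\<theta>. \<Sum>i<n. t i \<theta>) has_integral S n) {0..2 * pi}"
    "((\<lambda>\<theta>. exp (\<i> * of_real (\<rho> * cos (\<theta> - \<phi>))) * ?e \<theta>) has_integral J) {0..2 * pi}" "S \<longlonglongrightarrow> J"
    using uniform_limit_integral[OF lim cont] by auto
  have "S n = (\<Sum>i<n. I i)" for n
    using has_integral_unique[OF SJ(1)] has_integral_sum[of "{..<n}" t I] t_int by blast
  then have IJ: "I sums J" using SJ(3) unfolding sums_def by presburger
  \<comment> \<open>Reindexing discards the powers whose integral vanishes.\<close>
  have "(\<lambda>k. I (2 * k + ?p)) sums J"
    by (subst sums_mono_reindex[of "\<lambda>k. 2 * k + ?p"])
      (use IJ in \<open>auto simp: strict_mono_def I_def dest!: cos_weight_eq_0\<close>)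
  moreover have "I (2 * k + ?p) = 2 * pi * \<i> ^ ?p * ?e \<phi> *
      of_real ((- 1) ^ k / (fact k * fact (k + ?p)) * (\<rho> / 2) ^ (2 * k + ?p))" for k
  proof -
    define n where "n = 2 * k + ?p"
    have ch: "of_nat (n choose k) / fact n = (1 / (fact k * fact (k + ?p)) :: complex)"
      using binomial_fact[of k n, where 'a = complex] by (simp add: n_def mult_2)
    have "I n = 2 * pi * ?e \<phi> * ((\<i> * of_real \<rho>) ^ n / 2 ^ n) * (of_nat (n choose k) / fact n)"
      unfolding I_def n_def cos_weight_eq by (simp add: mult_ac)
    also have "(\<i> * of_real \<rho>) ^ n / 2 ^ n = \<i> ^ n * of_real ((\<rho> / 2) ^ n)"
      by (simp add: power_mult_distrib power_divide)
    also have "\<i> ^ n = (- 1) ^ k * \<i> ^ ?p" by (simp add: n_def power_add power_mult)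
    finally show ?thesis unfolding ch n_def[symmetric] by simp
  qed
  moreover have "(\<lambda>k. 2 * pi * \<i> ^ ?p * ?e \<phi> *
      of_real ((- 1) ^ k / (fact k * fact (k + ?p)) * (\<rho> / 2) ^ (2 * k + ?p)))
      sums (2 * pi * \<i> ^ ?p * ?e \<phi> * of_real (bessel_B ?p \<rho>))"
    by (intro sums_mult sums_of_real bessel_B_sums)
  ultimately have "J = 2 * pi * \<i> ^ ?p * ?e \<phi> * of_real (bessel_B ?p \<rho>)"
    using sums_unique2 by (simp only:) blast
  also have "\<dots> = 2 * pi * \<i> powi m * ?e \<phi> * of_real (bessel_J m \<rho>)"
    unfolding bessel_J_eq_bessel_B i_powi_order_sign[symmetric] by simp
  finally show ?thesis using SJ(2) by simp
qed

section \<open>Fourier-Bessel coefficients of plane waves\<close>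

lemma continuous_on_bessel_J [continuous_intros]:
  "continuous_on S g \<Longrightarrow> continuous_on S (\<lambda>x. bessel_J m (g x))"
  unfolding bessel_J_eq_bessel_B by (intro continuous_intros)

text \<open>The conjugate of \<open>Psi\<close> with the polar area factor \<open>r\<close>
  included. It omits the cut at r = 1, which agrees with \<open>Psi\<close> on the domain of
  integration and makes the kernel continuous everywhere.\<close>

definition FB_kernel :: "int \<Rightarrow> nat \<Rightarrow> real \<Rightarrow> real \<Rightarrow> complex" where
  "FB_kernel m n \<theta> r = exp (- (\<i> * of_int m * of_real \<theta>)) *
     of_real (r * bessel_J m (bessel_zero m n * r) / (sqrt pi * \<bar>bessel_J (m + 1) (bessel_zero m n)\<bar>))"

lemma continuous_on_FB_kernel [continuous_intros]:
  "continuous_on S f \<Longrightarrow> continuous_on S g \<Longrightarrow> continuous_on S (\<lambda>x. FB_kernel m n (f x) (g x))"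
  unfolding FB_kernel_def divide_inverse by (intro continuous_intros)

lemma continuous_on_polar:
  assumes "continuous_on UNIV h"
  shows "continuous_on S (\<lambda>(\<theta>, r). h (r * cos \<theta>, r * sin \<theta>) * FB_kernel m n \<theta> r)"
  unfolding case_prod_beta
  by (intro continuous_intros continuous_on_compose2[OF assms]) auto

text \<open>Passage from Lebesgue to gauge integrals, for which interchange and parameter continuity
  are available for continuous integrands; the two continuity claims serve linearity and norm
  estimates.\<close>

lemma FB_coeff_eq_integral:
  assumes "continuous_on UNIV h"
  shows "FB_coeff m n h =
    integral {0..2 * pi} (\<lambda>\<theta>. integral {0..1} (\<lambda>r. h (r * cos \<theta>, r * sin \<theta>) * FB_kernel m n \<theta> r))"
    and "continuous_on {0..2 * pi}
      (\<lambda>\<theta>. integral {0..1} (\<lambda>r. h (r * cos \<theta>, r * sin \<theta>) * FB_kernel m n \<theta> r))"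
    and "continuous_on {0..1} (\<lambda>r. h (r * cos \<theta>, r * sin \<theta>) * FB_kernel m n \<theta> r)"
proof -
  have c1: "continuous_on {0..1} (\<lambda>r. h (r * cos \<theta>, r * sin \<theta>) * FB_kernel m n \<theta> r)" for \<theta>
    by (intro continuous_intros continuous_on_compose2[OF assms]) auto
  have inner: "(LBINT r:{0..1}. h (r * cos \<theta>, r * sin \<theta>) * cnj (Psi m n r \<theta>) * of_real r)
      = integral {0..1} (\<lambda>r. h (r * cos \<theta>, r * sin \<theta>) * FB_kernel m n \<theta> r)" for \<theta>
  proof -
    have "(LBINT r:{0..1}. h (r * cos \<theta>, r * sin \<theta>) * cnj (Psi m n r \<theta>) * of_real r)
      = (LBINT r:{0..1}. h (r * cos \<theta>, r * sin \<theta>) * FB_kernel m n \<theta> r)"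
      by (intro set_lebesgue_integral_cong) (auto simp: Psi_def FB_kernel_def exp_cnj)
    also have "\<dots> = integral {0..1} (\<lambda>r. h (r * cos \<theta>, r * sin \<theta>) * FB_kernel m n \<theta> r)"
      by (intro set_borel_integral_eq_integral borel_integrable_atLeastAtMost' c1)
    finally show ?thesis .
  qed
  have c2: "continuous_on {0..2 * pi}
      (\<lambda>\<theta>. integral {0..1} (\<lambda>r. h (r * cos \<theta>, r * sin \<theta>) * FB_kernel m n \<theta> r))"
    using integral_continuous_on_param[of "{0..2 * pi}" 0 "1 :: real"
        "\<lambda>\<theta> r. h (r * cos \<theta>, r * sin \<theta>) * FB_kernel m n \<theta> r"] continuous_on_polar[OF assms]
    by simp
  have "FB_coeff m n h = (LBINT \<theta>:{0..2 * pi}.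
      integral {0..1} (\<lambda>r. h (r * cos \<theta>, r * sin \<theta>) * FB_kernel m n \<theta> r))"
    unfolding FB_coeff_def inner ..
  also have "\<dots> = integral {0..2 * pi}
      (\<lambda>\<theta>. integral {0..1} (\<lambda>r. h (r * cos \<theta>, r * sin \<theta>) * FB_kernel m n \<theta> r))"
    by (intro set_borel_integral_eq_integral borel_integrable_atLeastAtMost' c2)
  finally show "FB_coeff m n h = integral {0..2 * pi}
      (\<lambda>\<theta>. integral {0..1} (\<lambda>r. h (r * cos \<theta>, r * sin \<theta>) * FB_kernel m n \<theta> r))" .
  show "continuous_on {0..2 * pi}
      (\<lambda>\<theta>. integral {0..1} (\<lambda>r. h (r * cos \<theta>, r * sin \<theta>) * FB_kernel m n \<theta> r))" by (rule c2)
  show "continuous_on {0..1} (\<lambda>r. h (r * cos \<theta>, r * sin \<theta>) * FB_kernel m n \<theta> r)" by (rule c1)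
qed

lemma FB_coeff_add:
  assumes "continuous_on UNIV u" "continuous_on UNIV v"
  shows "FB_coeff m n (\<lambda>x. u x + v x) = FB_coeff m n u + FB_coeff m n v"
proof -
  have "integral {0..1} (\<lambda>r. (u (r * cos \<theta>, r * sin \<theta>) + v (r * cos \<theta>, r * sin \<theta>)) * FB_kernel m n \<theta> r)
     = integral {0..1} (\<lambda>r. u (r * cos \<theta>, r * sin \<theta>) * FB_kernel m n \<theta> r)
     + integral {0..1} (\<lambda>r. v (r * cos \<theta>, r * sin \<theta>) * FB_kernel m n \<theta> r)" for \<theta>
    unfolding distrib_right
    by (intro integral_add integrable_continuous_real FB_coeff_eq_integral(3) assms)
  then show ?thesis
    using assms by (simp add: FB_coeff_eq_integral(1) continuous_on_add integral_add
        integrable_continuous_real FB_coeff_eq_integral(2))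
qed

lemma FB_coeff_cmult:
  assumes "continuous_on UNIV u"
  shows "FB_coeff m n (\<lambda>x. a * u x) = a * FB_coeff m n u"
  using assms by (simp add: FB_coeff_eq_integral(1) continuous_on_mult_left mult.assoc)

lemma FB_coeff_sum:
  assumes "finite A" "\<And>k. k \<in> A \<Longrightarrow> continuous_on UNIV (u k)"
  shows "FB_coeff m n (\<lambda>x. \<Sum>k\<in>A. a k * u k x) = (\<Sum>k\<in>A. a k * FB_coeff m n (u k))"
  using assms
proof (induction A rule: finite_induct)
  case empty
  show ?case by (simp add: FB_coeff_eq_integral(1))
next
  case (insert k A)
  then show ?case
    by (simp add: FB_coeff_add FB_coeff_cmult continuous_on_mult_left continuous_on_sum)
qed

text \<open>Boundedness of the functional in the sup norm; \<open>M\<close> becomes the constant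
  gamma of the theorem. It is the maximum of the kernel on the unit interval times 2 pi, the length
  of the angular interval.\<close>

lemma FB_coeff_bound:
  obtains M where "M > 0"
    "\<And>u v E. continuous_on UNIV u \<Longrightarrow> continuous_on UNIV v \<Longrightarrow>
      (\<And>x y. \<bar>x\<bar> \<le> 1 \<Longrightarrow> \<bar>y\<bar> \<le> 1 \<Longrightarrow> cmod (u (x, y) - v (x, y)) \<le> E) \<Longrightarrow>
      cmod (FB_coeff m n u - FB_coeff m n v) \<le> M * E"
proof -
  have "compact ((\<lambda>r. FB_kernel m n 0 r) ` {0..1})"
    by (intro compact_continuous_image continuous_intros compact_Icc)
  then have "bounded ((\<lambda>r. FB_kernel m n 0 r) ` {0..1})" by (rule compact_imp_bounded)
  then obtain N where N: "N > 0" "\<forall>x \<in> (\<lambda>r. FB_kernel m n 0 r) ` {0..1}. cmod x \<le> N"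
    unfolding bounded_pos by blast
  \<comment> \<open>The angle enters the kernel only as a phase, so a bound at angle 0 serves all
    angles.\<close>
  have NN: "cmod (FB_kernel m n \<theta> r) \<le> N" if "r \<in> {0..1}" for \<theta> r
  proof -
    have "cmod (FB_kernel m n \<theta> r) = cmod (FB_kernel m n 0 r)"
      unfolding FB_kernel_def norm_mult by simp
    then show ?thesis using N(2) that by simp
  qed
  show thesis
  proof (rule that[of "N * (2 * pi)"])
    fix u v :: "real \<times> real \<Rightarrow> complex" and E :: real
    assume uv: "continuous_on UNIV u" "continuous_on UNIV v"
      and E: "\<And>x y. \<bar>x\<bar> \<le> 1 \<Longrightarrow> \<bar>y\<bar> \<le> 1 \<Longrightarrow> cmod (u (x, y) - v (x, y)) \<le> E"
    define w where "w = (\<lambda>x. u x + (- 1) * v x)"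
    have w: "continuous_on UNIV w" unfolding w_def by (intro continuous_intros uv)
    have wE: "cmod (w (x, y)) \<le> E" if "\<bar>x\<bar> \<le> 1" "\<bar>y\<bar> \<le> 1" for x y
      using E[OF that] by (simp add: w_def)
    have "FB_coeff m n w = FB_coeff m n u + (- 1) * FB_coeff m n v"
      unfolding w_def using uv by (simp only: FB_coeff_add FB_coeff_cmult continuous_on_mult_left)
    then have eq: "FB_coeff m n u - FB_coeff m n v = FB_coeff m n w" by simp
    have "cmod (integral {0..1} (\<lambda>r. w (r * cos \<theta>, r * sin \<theta>) * FB_kernel m n \<theta> r)) \<le> (E * N) * (1 - 0)" for \<theta>
    proof (rule integral_bound)
      show "\<And>r. r \<in> {0..1} \<Longrightarrow> cmod (w (r * cos \<theta>, r * sin \<theta>) * FB_kernel m n \<theta> r) \<le> E * N"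
      proof -
        fix r :: real assume r: "r \<in> {0..1}"
        have "\<bar>r * cos \<theta>\<bar> \<le> 1" "\<bar>r * sin \<theta>\<bar> \<le> 1"
          using r abs_cos_le_one[of \<theta>] abs_sin_le_one[of \<theta>] unfolding abs_mult
          by (intro mult_le_one; simp)+
        then have "cmod (w (r * cos \<theta>, r * sin \<theta>)) \<le> E" by (rule wE)
        moreover have "E \<ge> 0" using wE[of 0 0] norm_ge_zero[of "w (0, 0)"] by linarith
        ultimately show "cmod (w (r * cos \<theta>, r * sin \<theta>) * FB_kernel m n \<theta> r) \<le> E * N"
          unfolding norm_mult by (intro mult_mono NN r) auto
      qed
      show "continuous_on {0..1} (\<lambda>r. w (r * cos \<theta>, r * sin \<theta>) * FB_kernel m n \<theta> r)"
        by (rule FB_coeff_eq_integral(3)[OF w])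
    qed simp
    then have "cmod (FB_coeff m n w) \<le> (E * N) * (2 * pi - 0)"
      unfolding FB_coeff_eq_integral(1)[OF w]
      by (intro integral_bound FB_coeff_eq_integral(2)[OF w]) simp_all
    then show "cmod (FB_coeff m n u - FB_coeff m n v) \<le> N * (2 * pi) * E"
      unfolding eq by (simp add: mult_ac)
  qed (use N in simp)
qed

lemma knorm_kangle:
  "of_int (fst k) * cos \<theta> + of_int (snd k) * sin \<theta> = knorm k * cos (\<theta> - kangle k)"
proof -
  let ?z = "Complex (of_int (fst k)) (of_int (snd k))"
  have "knorm k = cmod ?z" by (simp add: knorm_def norm_Pair cmod_def)
  moreover have "?z = of_real (cmod ?z) * cis (Arg ?z)"
    using rcis_cmod_Arg[of ?z] by (simp add: rcis_def)
  ultimately have "Re ?z = knorm k * cos (kangle k)" "Im ?z = knorm k * sin (kangle k)"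
    unfolding kangle_def by (metis Re_rcis rcis_cmod_Arg) (metis Im_rcis rcis_cmod_Arg \<open>knorm k = cmod ?z\<close>)
  then show ?thesis by (simp add: cos_diff algebra_simps)
qed

definition plane_wave :: "int \<times> int \<Rightarrow> real \<times> real \<Rightarrow> complex" where
  "plane_wave k x = exp (\<i> * of_real (pi * (of_int (fst k) * fst x + of_int (snd k) * snd x)))"

lemma continuous_on_plane_wave: "continuous_on S (plane_wave k)"
  unfolding plane_wave_def[abs_def] by (intro continuous_intros)

text \<open>This identifies \<open>c_coeff\<close>: the angular integral contributes J_m(pi |k| r)
  with the phase of \<open>k\<close>, and the radial integral then contributes the quotient.\<close>

lemma FB_coeff_plane_wave:
  assumes "n \<ge> 1"
  shows "FB_coeff m n (plane_wave k) = 4 * c_coeff k m n"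
proof -
  let ?z = "bessel_zero m n" and ?e = "exp (- (\<i> * of_int m * of_real (kangle k)))"
  let ?t = "pi * knorm k"
  define J1 where "J1 = \<bar>bessel_J (m + 1) ?z\<bar>"
  have J1: "J1 \<noteq> 0"
    using bessel_zero_properties(3)[OF assms, of m] by (auto simp: J1_def abs_bessel_J_next[OF assms])
  have cont: "continuous_on (cbox (0, 0) (2 * pi, 1))
      (\<lambda>(\<theta>, r). plane_wave k (r * cos \<theta>, r * sin \<theta>) * FB_kernel m n \<theta> r)"
    by (rule continuous_on_polar) (rule continuous_on_plane_wave)
  have "FB_coeff m n (plane_wave k) =
      integral {0..2 * pi} (\<lambda>\<theta>. integral {0..1} (\<lambda>r. plane_wave k (r * cos \<theta>, r * sin \<theta>) * FB_kernel m n \<theta> r))"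
    by (rule FB_coeff_eq_integral) (rule continuous_on_plane_wave)
  \<comment> \<open>The angular integral is brought inside so that Bessel's integral applies for
    each fixed radius.\<close>
  also have "\<dots> = integral {0..1} (\<lambda>r. integral {0..2 * pi}
      (\<lambda>\<theta>. plane_wave k (r * cos \<theta>, r * sin \<theta>) * FB_kernel m n \<theta> r))"
    using integral_swap_continuous[OF cont] by simp
  also have "\<dots> = integral {0..1} (\<lambda>r. 2 * pi * \<i> powi m * ?e / of_real (sqrt pi * J1) *
      of_real (r * bessel_J m (?z * r) * bessel_J m (?t * r)))"
  proof (rule integral_cong)
    fix r :: real
    have pw: "plane_wave k (r * cos \<theta>, r * sin \<theta>) = exp (\<i> * of_real ((?t * r) * cos (\<theta> - kangle k)))" for \<theta>
    proof -
      have "pi * (of_int (fst k) * (r * cos \<theta>) + of_int (snd k) * (r * sin \<theta>))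
          = pi * r * (of_int (fst k) * cos \<theta> + of_int (snd k) * sin \<theta>)" by (simp add: algebra_simps)
      then show ?thesis unfolding plane_wave_def fst_conv snd_conv knorm_kangle by (simp add: mult_ac)
    qed
    let ?c = "of_real (r * bessel_J m (?z * r) / (sqrt pi * J1)) :: complex"
    have "((\<lambda>\<theta>. ?c * (exp (\<i> * of_real ((?t * r) * cos (\<theta> - kangle k))) * exp (- (\<i> * of_int m * of_real \<theta>))))
      has_integral ?c * (2 * pi * \<i> powi m * ?e * of_real (bessel_J m (?t * r)))) {0..2 * pi}"
      by (intro has_integral_mult_right bessel_J_angular)
    then have "integral {0..2 * pi} (\<lambda>\<theta>. ?c * (exp (\<i> * of_real ((?t * r) * cos (\<theta> - kangle k))) *
        exp (- (\<i> * of_int m * of_real \<theta>)))) = ?c * (2 * pi * \<i> powi m * ?e * of_real (bessel_J m (?t * r)))"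
      by (rule integral_unique)
    moreover have "plane_wave k (r * cos \<theta>, r * sin \<theta>) * FB_kernel m n \<theta> r =
       ?c * (exp (\<i> * of_real ((?t * r) * cos (\<theta> - kangle k))) * exp (- (\<i> * of_int m * of_real \<theta>)))" for \<theta>
      unfolding pw FB_kernel_def J1_def[symmetric] by (simp only: mult_ac)
    ultimately show "integral {0..2 * pi} (\<lambda>\<theta>. plane_wave k (r * cos \<theta>, r * sin \<theta>) * FB_kernel m n \<theta> r)
       = 2 * pi * \<i> powi m * ?e / of_real (sqrt pi * J1) *
          of_real (r * bessel_J m (?z * r) * bessel_J m (?t * r))"
      by (simp add: mult_ac)
  qed
  also have "\<dots> = 2 * pi * \<i> powi m * ?e / of_real (sqrt pi * J1) *
      of_real ((- 1) ^ n * order_sign m * ?z * J1 * bessel_quot m n ?t)"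
  proof (intro integral_unique has_integral_mult_right)
    have "((\<lambda>r. r * bessel_J m (?z * r) * bessel_J m (?t * r)) has_integral
        (- 1) ^ n * order_sign m * ?z * J1 * bessel_quot m n ?t) {0..1}"
      unfolding J1_def by (rule bessel_quot_integral[OF assms]) (simp add: knorm_def)
    from has_integral_linear[OF this bounded_linear_of_real]
    show "((\<lambda>r. of_real (r * bessel_J m (?z * r) * bessel_J m (?t * r)) :: complex) has_integral
        of_real ((- 1) ^ n * order_sign m * ?z * J1 * bessel_quot m n ?t)) {0..1}"
      by (simp only: o_def)
  qed
  \<comment> \<open>The normalising factor \<open>J1\<close> of the kernel cancels against the one
    from the radial integral.\<close>
  also have "\<dots> = (of_real pi / of_real (sqrt pi)) * (2 * \<i> powi m * ?e *
      ((- 1) ^ n * of_real (order_sign m) * of_real ?z * of_real (bessel_quot m n ?t)))"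
    using J1 by simp
  also have "of_real pi / of_real (sqrt pi) = (of_real (sqrt pi) :: complex)"
    unfolding of_real_divide[symmetric] by (simp add: real_div_sqrt)
  also have "of_real (sqrt pi) * (2 * \<i> powi m * ?e *
      ((- 1) ^ n * of_real (order_sign m) * of_real ?z * of_real (bessel_quot m n ?t))) = 4 * c_coeff k m n"
  proof -
    have "(if 0 \<le> m then 1 else (- 1) powi m) = (of_real (order_sign m) :: complex)"
      by (cases "0 \<le> m") (simp_all add: order_sign_def)
    then show ?thesis unfolding c_coeff_def by (simp only:) simp
  qed
  finally show ?thesis .
qed

section \<open>The finite Fourier transform\<close>

definition grid :: "nat \<Rightarrow> nat \<Rightarrow> real" where
  "grid L i = - 1 + (real i - 1) * (2 / real L)"

definition wave :: "int \<Rightarrow> real \<Rightarrow> complex" where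
  "wave k x = exp (\<i> * of_real (pi * of_int k * x))"

lemma wave_add: "wave k (x + y) = wave k x * wave k y"
  by (simp add: wave_def algebra_simps exp_add)

lemma wave_diff_arg: "wave k (x - y) = wave k x * cnj (wave k y)"
  using wave_add[of k x "- y"] by (simp add: wave_def exp_cnj)

lemma cnj_wave: "cnj (wave k x) = wave k (- x)"
  by (simp add: wave_def exp_cnj)

lemma norm_wave [simp]: "cmod (wave k x) = 1"
  by (simp add: wave_def)

lemma plane_wave_eq: "plane_wave k (x, y) = wave (fst k) x * wave (snd k) y"
  by (simp add: plane_wave_def wave_def exp_add[symmetric] algebra_simps)

text \<open>A geometric sum of \<open>L\<close> consecutive powers of an L-th root of unity: it is 0
  unless the root is 1. The phase of the first term then equals 1 as well.\<close>

lemma sum_wave: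
  fixes a :: int and K :: nat
  defines "L \<equiv> 2 * K + 1"
  shows "(\<Sum>k = - int K..int K. wave k (2 * of_int a / real L)) = (if int L dvd a then of_nat L else 0)"
proof -
  let ?x = "2 * of_int a / real L"
  define w where "w = wave 1 ?x"
  have pow: "wave (of_nat j) ?x = w ^ j" for j
    unfolding w_def wave_def by (simp add: exp_of_nat_mult[symmetric] mult_ac)
  have wL: "w ^ L = 1"
  proof -
    have "real L \<noteq> 0" by (simp add: L_def)
    then have "w ^ L = exp (2 * of_real pi * \<i> * of_int a)"
      unfolding w_def wave_def exp_of_nat_mult[symmetric] by (simp add: field_simps)
    then show ?thesis using exp_integer_2pi[of "of_int a"] by (simp add: mult_ac)
  qed
  have w1: "w = 1 \<longleftrightarrow> int L dvd a"
  proof -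
    have "w = 1 \<longleftrightarrow> (\<exists>n::int. pi * (2 * of_int a / real L) = of_int (2 * n) * pi)"
      unfolding w_def wave_def exp_eq_1 by simp
    also have "\<dots> \<longleftrightarrow> (\<exists>n::int. a = int L * n)"
    proof (rule ex_cong1)
      fix n :: int
      have "pi * (2 * of_int a / real L) = of_int (2 * n) * pi \<longleftrightarrow> (of_int a :: real) = of_int (int L * n)"
      proof -
        have "real L \<noteq> 0" by (simp add: L_def)
        then have "pi * (2 * of_int a / real L) = of_int (2 * n) * pi
            \<longleftrightarrow> pi * 2 * of_int a = pi * 2 * (real L * of_int n)"
          by (simp add: field_simps)
        then show ?thesis by simp
      qed
      then show "pi * (2 * of_int a / real L) = of_int (2 * n) * pi \<longleftrightarrow> a = int L * n"
        by (simp only: of_int_eq_iff)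
    qed
    finally show ?thesis by (simp add: dvd_def)
  qed
  have "(\<Sum>k = - int K..int K. wave k ?x) = (\<Sum>j<L. wave (int j - int K) ?x)"
    by (rule sum.reindex_bij_witness[of _ "\<lambda>j. int j - int K" "\<lambda>k. nat (k + int K)"]) (auto simp: L_def)
  also have "\<dots> = (\<Sum>j<L. wave (- int K) ?x * w ^ j)"
  proof (intro sum.cong refl)
    fix j
    have "wave (int j - int K) ?x = wave (- int K) ?x * wave (int j) ?x"
      by (simp add: wave_def exp_add[symmetric] algebra_simps diff_divide_distrib)
    then show "wave (int j - int K) ?x = wave (- int K) ?x * w ^ j" by (simp only: pow)
  qed
  also have "\<dots> = wave (- int K) ?x * (\<Sum>j<L. w ^ j)" by (simp only: sum_distrib_left)
  also have "\<dots> = (if int L dvd a then of_nat L else 0)"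
  proof (cases "w = 1")
    case True
    have "wave (- int K) ?x * wave (int K) ?x = 1"
      by (simp add: wave_def exp_add[symmetric])
    then have "wave (- int K) ?x = 1" using True pow[of K] by simp
    then show ?thesis using True w1 by simp
  next
    case False
    then have "(\<Sum>j<L. w ^ j) = 0" using wL by (simp add: geometric_sum)
    then show ?thesis using False w1 by simp
  qed
  finally show ?thesis .
qed

lemma sum_wave_grid_diff:
  fixes K i j :: nat
  defines "L \<equiv> 2 * K + 1"
  assumes "i \<in> {1..L}" "j \<in> {1..L}"
  shows "(\<Sum>k = - int K..int K. wave k (grid L i - grid L j)) = (if i = j then of_nat L else 0)"
proof -
  have "grid L i - grid L j = 2 * of_int (int i - int j) / real L"
    by (simp add: grid_def algebra_simps diff_divide_distrib)
  moreover have "int L dvd (int i - int j) \<longleftrightarrow> i = j"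
  proof
    assume "int L dvd (int i - int j)"
    moreover have "\<bar>int i - int j\<bar> < int L" using assms by auto
    ultimately show "i = j" using zdvd_not_zless[of "\<bar>int i - int j\<bar>" "int L"] by fastforce
  qed simp
  ultimately show ?thesis using sum_wave[of "int i - int j" K] by (simp add: L_def)
qed

section \<open>Discrete Parseval identities\<close>

lemma parseval_1:
  fixes K :: nat and a :: "nat \<Rightarrow> complex"
  defines "L \<equiv> 2 * K + 1"
  shows "(\<Sum>k = - int K..int K. (cmod (\<Sum>i = 1..L. a i * cnj (wave k (grid L i))))\<^sup>2)
    = real L * (\<Sum>i = 1..L. (cmod (a i))\<^sup>2)"
proof -
  have "complex_of_real (\<Sum>k = - int K..int K. (cmod (\<Sum>i = 1..L. a i * cnj (wave k (grid L i))))\<^sup>2)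
    = (\<Sum>k = - int K..int K. \<Sum>i = 1..L. \<Sum>j = 1..L. a i * cnj (a j) * wave k (grid L j - grid L i))"
    unfolding of_real_sum complex_norm_square by (simp add: sum_product wave_diff_arg mult_ac)
  also have "\<dots> = (\<Sum>i = 1..L. \<Sum>j = 1..L. a i * cnj (a j) * (\<Sum>k = - int K..int K. wave k (grid L j - grid L i)))"
    unfolding sum_distrib_left
    by (subst sum.swap, intro sum.cong refl, subst sum.swap, rule refl)
  also have "\<dots> = (\<Sum>i = 1..L. \<Sum>j = 1..L. if i = j then a i * cnj (a j) * of_nat L else 0)"
  proof (intro sum.cong refl)
    fix i j assume "i \<in> {1..L}" "j \<in> {1..L}"
    then have "(\<Sum>k = - int K..int K. wave k (grid L j - grid L i)) = (if j = i then of_nat L else 0)"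
      unfolding L_def by (intro sum_wave_grid_diff)
    then show "a i * cnj (a j) * (\<Sum>k = - int K..int K. wave k (grid L j - grid L i))
        = (if i = j then a i * cnj (a j) * of_nat L else 0)" by simp
  qed
  also have "\<dots> = complex_of_real (real L * (\<Sum>i = 1..L. (cmod (a i))\<^sup>2))"
    unfolding of_real_mult of_real_sum complex_norm_square by (simp add: sum_distrib_left mult_ac)
  finally show ?thesis by (simp only: of_real_eq_iff)
qed

lemma parseval_2:
  fixes K :: nat and a :: "nat \<Rightarrow> nat \<Rightarrow> complex"
  defines "L \<equiv> 2 * K + 1"
  shows "(\<Sum>k1 = - int K..int K. \<Sum>k2 = - int K..int K.
      (cmod (\<Sum>i = 1..L. \<Sum>j = 1..L. a i j * (cnj (wave k1 (grid L i)) * cnj (wave k2 (grid L j)))))\<^sup>2)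
    = (real L)\<^sup>2 * (\<Sum>i = 1..L. \<Sum>j = 1..L. (cmod (a i j))\<^sup>2)"
proof -
  have inner: "(\<Sum>i = 1..L. \<Sum>j = 1..L. a i j * (cnj (wave k1 (grid L i)) * cnj (wave k2 (grid L j))))
      = (\<Sum>i = 1..L. (\<Sum>j = 1..L. a i j * cnj (wave k2 (grid L j))) * cnj (wave k1 (grid L i)))" for k1 k2
    by (simp add: sum_distrib_right sum_distrib_left mult_ac)
  have "(\<Sum>k1 = - int K..int K. \<Sum>k2 = - int K..int K.
      (cmod (\<Sum>i = 1..L. \<Sum>j = 1..L. a i j * (cnj (wave k1 (grid L i)) * cnj (wave k2 (grid L j)))))\<^sup>2)
    = (\<Sum>k2 = - int K..int K. \<Sum>k1 = - int K..int K.
      (cmod (\<Sum>i = 1..L. (\<Sum>j = 1..L. a i j * cnj (wave k2 (grid L j))) * cnj (wave k1 (grid L i))))\<^sup>2)"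
    unfolding inner by (rule sum.swap)
  also have "\<dots> = (\<Sum>k2 = - int K..int K. real L *
      (\<Sum>i = 1..L. (cmod (\<Sum>j = 1..L. a i j * cnj (wave k2 (grid L j))))\<^sup>2))"
    unfolding L_def parseval_1 ..
  also have "\<dots> = real L * (\<Sum>i = 1..L. \<Sum>k2 = - int K..int K.
      (cmod (\<Sum>j = 1..L. a i j * cnj (wave k2 (grid L j))))\<^sup>2)"
    by (subst sum.swap) (simp only: sum_distrib_left)
  also have "\<dots> = (real L)\<^sup>2 * (\<Sum>i = 1..L. \<Sum>j = 1..L. (cmod (a i j))\<^sup>2)"
    unfolding L_def parseval_1 by (simp only: sum_distrib_left power2_eq_square mult_ac)
  finally show ?thesis .
qed

lemma finite_fourier_eq:
  "finite_fourier f k L = of_real ((2 / real L)\<^sup>2) * (\<Sum>i = 1..L. \<Sum>j = 1..L.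
     f (grid L i, grid L j) * (cnj (wave (fst k) (grid L i)) * cnj (wave (snd k) (grid L j))))"
proof -
  have "exp (- (of_real pi * \<i> * of_real (of_int (fst k) * x + of_int (snd k) * y)))
      = cnj (wave (fst k) x) * cnj (wave (snd k) y)" for x y
    by (simp add: wave_def exp_cnj exp_add[symmetric] algebra_simps)
  then show ?thesis unfolding finite_fourier_def Let_def grid_def[symmetric] by simp
qed

text \<open>All that the estimates use of a C^1 function and its support, with one constant for size
  and variation. The ball is relaxed to a square and the metric to the l^1 metric because the grid
  arguments work coordinatewise.\<close>

definition lipschitz_bump :: "real \<Rightarrow> (real \<times> real \<Rightarrow> complex) \<Rightarrow> bool" where
  "lipschitz_bump B f \<longleftrightarrow> (\<forall>x. cmod (f x) \<le> B) \<and>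
    (\<forall>x y x' y'. cmod (f (x, y) - f (x', y')) \<le> B * (\<bar>x - x'\<bar> + \<bar>y - y'\<bar>)) \<and>
    (\<forall>x y. \<bar>x\<bar> \<ge> 1 / 2 \<or> \<bar>y\<bar> \<ge> 1 / 2 \<longrightarrow> f (x, y) = 0)"

lemma lipschitz_bumpD:
  assumes "lipschitz_bump B f"
  shows "cmod (f x) \<le> B" "cmod (f (a, b) - f (a', b')) \<le> B * (\<bar>a - a'\<bar> + \<bar>b - b'\<bar>)"
    "\<bar>a\<bar> \<ge> 1 / 2 \<or> \<bar>b\<bar> \<ge> 1 / 2 \<Longrightarrow> f (a, b) = 0" "B \<ge> 0"
  using assms norm_ge_zero[of "f x"] unfolding lipschitz_bump_def by (blast, blast, blast, metis order_trans norm_ge_zero)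

lemma lipschitz_bump_swap:
  assumes "lipschitz_bump B f"
  shows "lipschitz_bump B (f \<circ> prod.swap)"
  unfolding lipschitz_bump_def
proof (intro conjI allI impI)
  show "cmod ((f \<circ> prod.swap) (x, y) - (f \<circ> prod.swap) (x', y')) \<le> B * (\<bar>x - x'\<bar> + \<bar>y - y'\<bar>)" for x y x' y'
    using lipschitz_bumpD(2)[OF assms, of y x y' x'] by (simp add: add.commute)
qed (use lipschitz_bumpD(1,3)[OF assms] in auto)

lemma finite_fourier_swap:
  "finite_fourier (f \<circ> prod.swap) k L = finite_fourier f (prod.swap k) L"
  unfolding finite_fourier_eq by (subst (2) sum.swap) (simp add: mult.commute)

text \<open>Parseval turns the sum into (2 / L)^4 L^2 times at most L^2 B^2, hence the constant
  16.\<close>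

lemma finite_fourier_l2:
  fixes K :: nat
  defines "L \<equiv> 2 * K + 1"
  assumes "lipschitz_bump B f"
  shows "(\<Sum>k1 = - int K..int K. \<Sum>k2 = - int K..int K. (cmod (finite_fourier f (k1, k2) L))\<^sup>2) \<le> 16 * B\<^sup>2"
proof -
  have N: "cmod (complex_of_real ((2 / real L)\<^sup>2)) = (2 / real L)\<^sup>2"
    unfolding norm_of_real by simp
  have "(\<Sum>k1 = - int K..int K. \<Sum>k2 = - int K..int K. (cmod (finite_fourier f (k1, k2) L))\<^sup>2)
     = ((2 / real L)\<^sup>2)\<^sup>2 * ((real L)\<^sup>2 * (\<Sum>i = 1..L. \<Sum>j = 1..L. (cmod (f (grid L i, grid L j)))\<^sup>2))"
    unfolding finite_fourier_eq norm_mult N power_mult_distrib sum_distrib_left[symmetric] fst_conv snd_conv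
    unfolding L_def parseval_2 ..
  also have "\<dots> \<le> ((2 / real L)\<^sup>2)\<^sup>2 * ((real L)\<^sup>2 * (\<Sum>i = 1..L. \<Sum>j = 1..L. B\<^sup>2))"
    using lipschitz_bumpD(1)[OF assms(2)] by (intro mult_left_mono sum_mono power_mono) auto
  also have "\<dots> = 16 * B\<^sup>2"
  proof -
    have "real L \<noteq> 0" by (simp add: L_def)
    then show ?thesis by (simp add: power2_eq_square)
  qed
  finally show ?thesis .
qed

text \<open>By the double angle formula, sin x = 2 sin(x / 2) cos(x / 2); on [0, pi / 4] the cosine
  is at least c = sqrt 2 / 2, hence sin t >= c t there, and c^2 = 1 / 2.\<close>

lemma sin_ge_half:
  assumes "0 \<le> x" "x \<le> pi / 2"
  shows "x / 2 \<le> sin x"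
proof -
  define c where "c = sqrt 2 / 2"
  have c: "c \<ge> 0" "c * c = 1 / 2" by (simp_all add: c_def)
  have cos_ge: "c \<le> cos t" if "0 \<le> t" "t \<le> pi / 4" for t
    using that cos_monotone_0_pi_le[of t "pi / 4"] by (simp add: c_def cos_45)
  have "sin 0 - c * 0 \<le> sin (x / 2) - c * (x / 2)"
  proof (rule DERIV_nonneg_imp_nondecreasing[of 0 "x / 2" "\<lambda>t. sin t - c * t"])
    fix t assume "0 \<le> t" "t \<le> x / 2"
    then show "\<exists>y. ((\<lambda>t. sin t - c * t) has_real_derivative y) (at t) \<and> 0 \<le> y"
      using assms cos_ge[of t] by (intro exI[of _ "cos t - c"]) (auto intro!: derivative_eq_intros)
  qed (use assms in simp)
  then have "c * (x / 2) * c \<le> sin (x / 2) * cos (x / 2)"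
    using assms c cos_ge[of "x / 2"] sin_ge_zero[of "x / 2"] by (intro mult_mono) auto
  moreover have "c * (x / 2) * c = x / 4" using c(2) by (simp add: mult_ac)
  ultimately have "x / 4 \<le> sin (x / 2) * cos (x / 2)" by (simp only:)
  then show ?thesis using sin_double[of "x / 2"] by simp
qed

text \<open>The modulus is 2 |sin(t / 2)| with t = pi k x, hence at least |t| / 2; then pi >= 2 is
  used.\<close>

lemma norm_wave_minus_1:
  assumes "\<bar>pi * of_int k * x\<bar> \<le> pi"
  shows "\<bar>of_int k\<bar> * \<bar>x\<bar> \<le> cmod (wave k x - 1)"
proof -
  let ?t = "pi * of_int k * x"
  have "\<bar>?t\<bar> / 2 / 2 \<le> sin (\<bar>?t\<bar> / 2)" by (rule sin_ge_half) (use assms in auto)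
  also have "\<dots> \<le> \<bar>sin (?t / 2)\<bar>" by (cases "?t \<ge> 0") auto
  finally have "\<bar>?t\<bar> / 2 \<le> cmod (wave k x - 1)" unfolding wave_def dist_exp_i_1 by simp
  moreover have "2 * (\<bar>of_int k\<bar> * \<bar>x\<bar>) \<le> \<bar>?t\<bar>"
    unfolding abs_mult mult.assoc using pi_ge_two by (intro mult_right_mono) auto
  ultimately show ?thesis by simp
qed

lemma norm_wave_diff: "cmod (wave k x - wave k y) \<le> pi * \<bar>of_int k\<bar> * \<bar>x - y\<bar>"
proof -
  have "wave k x - wave k y = wave k y * (wave k (x - y) - 1)"
    by (simp add: algebra_simps wave_add[symmetric])
  then have "cmod (wave k x - wave k y) = cmod (wave k (x - y) - 1)"
    by (simp add: norm_mult)
  also have "\<dots> = 2 * \<bar>sin (pi * of_int k * (x - y) / 2)\<bar>"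
    unfolding wave_def dist_exp_i_1 ..
  also have "\<dots> \<le> 2 * \<bar>pi * of_int k * (x - y) / 2\<bar>" 
    by (intro mult_left_mono abs_sin_x_le_abs_x) auto
  finally show ?thesis by (simp add: abs_mult)
qed

text \<open>A discrete Sobolev bound: the transform of the forward difference of \<open>f\<close> is
  \<open>wave k1 \<delta> - 1\<close> times the transform of \<open>f\<close>. In the given
  frequency range that factor has modulus at least |k1| \<delta>, while Parseval bounds the
  differences, each of size at most B \<delta>.\<close>

lemma finite_fourier_h1:
  fixes K :: nat
  defines "L \<equiv> 2 * K + 1"
  assumes f: "lipschitz_bump B f"
  shows "(\<Sum>k1 = - int K..int K. \<Sum>k2 = - int K..int K.
     (\<bar>of_int k1\<bar> * cmod (finite_fourier f (k1, k2) L))\<^sup>2) \<le> 16 * B\<^sup>2"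
proof -
  define \<delta> where "\<delta> = 2 / real L"
  have \<delta>: "\<delta> > 0" by (simp add: \<delta>_def L_def)
  have step: "grid L (Suc i) = grid L i + \<delta>" for i 
    by (simp add: grid_def \<delta>_def algebra_simps add_divide_distrib diff_divide_distrib)
  let ?v = "\<lambda>i j. f (grid L (Suc i), grid L j) - f (grid L i, grid L j)"
  let ?V = "\<lambda>k1 k2. \<Sum>i = 1..L. \<Sum>j = 1..L. ?v i j * (cnj (wave k1 (grid L i)) * cnj (wave k2 (grid L j)))"
  have V: "of_real (\<delta>\<^sup>2) * ?V k1 k2 = (wave k1 \<delta> - 1) * finite_fourier f (k1, k2) L" for k1 k2
  proof -
    let ?s = "\<lambda>i. \<Sum>j = 1..L. f (grid L i, grid L j) * (cnj (wave k1 (grid L i)) * cnj (wave k2 (grid L j)))"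
    \<comment> \<open>Nodes 1 and L + 1 are the ends -1 and 1, outside the support, so summation by
      parts leaves no boundary terms.\<close>
    have "real L \<noteq> 0" by (simp add: L_def)
    then have "grid L 1 = - 1" "grid L (Suc L) = 1" by (simp_all add: grid_def)
    then have s0: "?s 1 = 0" "?s (Suc L) = 0"
      using lipschitz_bumpD(3)[OF f] by simp_all
    have w: "cnj (wave k1 (grid L i)) = wave k1 \<delta> * cnj (wave k1 (grid L (Suc i)))" for i
      unfolding step cnj_wave wave_add[symmetric] by simp
    have "?V k1 k2 = (\<Sum>i = 1..L. wave k1 \<delta> * ?s (Suc i) - ?s i)"
    proof (intro sum.cong refl)
      fix i
      have "(\<Sum>j = 1..L. ?v i j * (cnj (wave k1 (grid L i)) * cnj (wave k2 (grid L j))))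
        = (\<Sum>j = 1..L. f (grid L (Suc i), grid L j) * (cnj (wave k1 (grid L i)) * cnj (wave k2 (grid L j)))) - ?s i"
        by (simp only: left_diff_distrib sum_subtractf)
      also have "(\<Sum>j = 1..L. f (grid L (Suc i), grid L j) * (cnj (wave k1 (grid L i)) * cnj (wave k2 (grid L j))))
        = wave k1 \<delta> * ?s (Suc i)"
        unfolding w[of i] sum_distrib_left by (simp only: mult_ac)
      finally show "(\<Sum>j = 1..L. ?v i j * (cnj (wave k1 (grid L i)) * cnj (wave k2 (grid L j))))
        = wave k1 \<delta> * ?s (Suc i) - ?s i" .
    qed
    also have "\<dots> = wave k1 \<delta> * (\<Sum>i = 1..L. ?s (Suc i)) - (\<Sum>i = 1..L. ?s i)"
      by (simp only: sum_subtractf sum_distrib_left)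
    also have "(\<Sum>i = 1..L. ?s (Suc i)) = (\<Sum>i = 1..L. ?s i)"
    proof -
      have "(\<Sum>i = 1..L. s (Suc i)) + s 1 = (\<Sum>i = 1..L. s i) + s (Suc L)" for s :: "nat \<Rightarrow> complex"
        using sum.shift_bounds_cl_Suc_ivl[of s 1 L] sum.atLeast_Suc_atMost[of 1 "Suc L" s]
          sum.nat_ivl_Suc'[of 1 L s] by (simp add: add.commute)
      from this[of ?s]
      show ?thesis unfolding s0 by simp
    qed
    finally have "?V k1 k2 = (wave k1 \<delta> - 1) * (\<Sum>i = 1..L. ?s i)"
      by (simp only: left_diff_distrib mult_1_left)
    then show ?thesis unfolding finite_fourier_eq fst_conv snd_conv \<delta>_def[symmetric]
      by (simp only: mult.left_commute)
  qed
  have low: "\<delta> * (\<bar>of_int k1\<bar> * cmod (finite_fourier f (k1, k2) L)) \<le> \<delta>\<^sup>2 * cmod (?V k1 k2)"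
    if "k1 \<in> {- int K..int K}" for k1 k2
  proof -
    \<comment> \<open>From |k1| <= K follows |k1| \<delta> <= 2 K / (2 K + 1) <= 1, which keeps the
      phase within pi.\<close>
    have "\<bar>of_int k1\<bar> \<le> real K" using that by simp linarith
    then have "\<bar>of_int k1\<bar> * \<delta> \<le> real K * \<delta>" using \<delta> by (intro mult_right_mono) auto
    also have "\<dots> \<le> 1" by (simp add: \<delta>_def L_def field_simps)
    finally have "\<bar>pi * of_int k1 * \<delta>\<bar> \<le> pi" using \<delta> by (simp add: abs_mult mult.assoc)
    then have "\<bar>of_int k1\<bar> * \<bar>\<delta>\<bar> \<le> cmod (wave k1 \<delta> - 1)" by (rule norm_wave_minus_1)
    then have "\<bar>of_int k1\<bar> * \<delta> * cmod (finite_fourier f (k1, k2) L)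
        \<le> cmod ((wave k1 \<delta> - 1) * finite_fourier f (k1, k2) L)"
      using \<delta> unfolding norm_mult by (intro mult_right_mono) auto
    then show ?thesis unfolding V[symmetric] using \<delta> by (simp add: norm_mult norm_power mult_ac)
  qed
  have "\<delta>\<^sup>2 * (\<Sum>k1 = - int K..int K. \<Sum>k2 = - int K..int K.
     (\<bar>of_int k1\<bar> * cmod (finite_fourier f (k1, k2) L))\<^sup>2)
    = (\<Sum>k1 = - int K..int K. \<Sum>k2 = - int K..int K.
     (\<delta> * (\<bar>of_int k1\<bar> * cmod (finite_fourier f (k1, k2) L)))\<^sup>2)"
    by (simp only: sum_distrib_left power_mult_distrib)
  also have "\<dots> \<le> (\<Sum>k1 = - int K..int K. \<Sum>k2 = - int K..int K. (\<delta>\<^sup>2 * cmod (?V k1 k2))\<^sup>2)"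
    using \<delta> by (intro sum_mono power_mono low) auto
  also have "\<dots> = (\<delta>\<^sup>2)\<^sup>2 * ((real L)\<^sup>2 * (\<Sum>i = 1..L. \<Sum>j = 1..L. (cmod (?v i j))\<^sup>2))"
    unfolding power_mult_distrib sum_distrib_left[symmetric] L_def parseval_2 ..
  also have "\<dots> \<le> (\<delta>\<^sup>2)\<^sup>2 * ((real L)\<^sup>2 * (\<Sum>i = 1..L. \<Sum>j = 1..L. (B * \<delta>)\<^sup>2))"
  proof (intro mult_left_mono sum_mono power_mono)
    show "cmod (?v i j) \<le> B * \<delta>" for i j
      using lipschitz_bumpD(2)[OF f, of "grid L (Suc i)" "grid L j" "grid L i" "grid L j"] \<delta>
      by (simp add: step)
  qed auto
  also have "\<dots> = (\<delta> * real L) ^ 4 * B\<^sup>2 * \<delta>\<^sup>2"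
    by (simp add: power2_eq_square power4_eq_xxxx)
  also have "\<delta> * real L = 2"
  proof -
    have "real L \<noteq> 0" by (simp add: L_def)
    then show ?thesis by (simp add: \<delta>_def)
  qed
  finally have "\<delta>\<^sup>2 * (\<Sum>k1 = - int K..int K. \<Sum>k2 = - int K..int K.
     (\<bar>of_int k1\<bar> * cmod (finite_fourier f (k1, k2) L))\<^sup>2) \<le> \<delta>\<^sup>2 * (16 * B\<^sup>2)" by (simp add: mult_ac)
  then show ?thesis using \<delta> by simp
qed

section \<open>The interpolating trigonometric polynomial\<close>

text \<open>The polynomial P of the overview: a truncated Fourier series of \<open>f * g\<close> on
  the period square, with discrete transforms in place of exact ones.\<close>

definition trig_conv :: "nat \<Rightarrow> (real \<times> real \<Rightarrow> complex) \<Rightarrow> (real \<times> real \<Rightarrow> complex) \<Rightarrow> real \<times> real \<Rightarrow> complex" where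
  "trig_conv K f g x = (\<Sum>k1 = - int K..int K. \<Sum>k2 = - int K..int K.
     finite_fourier f (k1, k2) (2 * K + 1) * finite_fourier g (k1, k2) (2 * K + 1) * plane_wave (k1, k2) x) / 4"

lemma FB_approx_eq_FB_coeff:
  assumes "n \<ge> 1"
  shows "FB_approx K m n f g = FB_coeff m n (trig_conv K f g)"
proof -
  let ?A = "{- int K..int K} \<times> {- int K..int K}"
  let ?a = "\<lambda>k. finite_fourier f k (2 * K + 1) * finite_fourier g k (2 * K + 1) / 4"
  have A: "{k. max \<bar>fst k\<bar> \<bar>snd k\<bar> \<le> int K} = ?A" by (auto simp: abs_le_iff)
  have "trig_conv K f g = (\<lambda>x. \<Sum>k\<in>?A. ?a k * plane_wave k x)"
    by (rule ext) (simp add: trig_conv_def sum.cartesian_product sum_divide_distrib case_prod_beta)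
  then have "FB_coeff m n (trig_conv K f g) = (\<Sum>k\<in>?A. ?a k * FB_coeff m n (plane_wave k))"
    by (simp only: FB_coeff_sum continuous_on_plane_wave finite_cartesian_product finite_atLeastAtMost_int)
  also have "\<dots> = FB_approx K m n f g"
    unfolding FB_approx_def A FB_coeff_plane_wave[OF assms] by (intro sum.cong refl) simp
  finally show ?thesis ..
qed

lemma continuous_on_trig_conv: "continuous_on S (trig_conv K f g)"
  unfolding trig_conv_def[abs_def] by (intro continuous_intros continuous_on_plane_wave) auto

text \<open>
  Since \<open>L\<close> is odd, sums of two grid points lie on the lattice \<open>(2 / L) \<int>\<close> and not on the grid itself.
  The supports keep the periodic wrap-around out.
\<close>

lemma periodic_sample:
  fixes K i :: nat and a :: int and G :: "real \<Rightarrow> complex"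
  defines "L \<equiv> 2 * K + 1"
  assumes G: "\<And>t. \<bar>t\<bar> \<ge> 1 / 2 \<Longrightarrow> G t = 0" and i: "\<bar>grid L i\<bar> < 1 / 2" and a: "\<bar>of_int a * (2 / real L)\<bar> \<le> 1"
  shows "(\<Sum>p = 1..L. G (grid L p) * (\<Sum>k = - int K..int K. wave k (of_int a * (2 / real L) - grid L i - grid L p)))
    = of_nat L * G (of_int a * (2 / real L) - grid L i)"
proof -
  have L0: "real L > 0" "int L > 0" by (simp_all add: L_def)
  define d where "d = 2 / real L"
  have Ld: "real L * d = 2" using L0 by (simp add: d_def)
  \<comment> \<open>With step d, the point a d - \<open>grid L i\<close> is 1 + c d, which modulo
    the period 2 is -1 + c d. So the residue of \<open>c\<close> modulo \<open>L\<close> gives the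
    index \<open>p0\<close> of the one grid point congruent to it.\<close>
  define c where "c = a + 1 - int i"
  define p0 where "p0 = Suc (nat (c mod int L))"
  have cm: "0 \<le> c mod int L" "c mod int L < int L" using L0 by auto
  have p0: "p0 \<in> {1..L}" using cm by (auto simp: p0_def)
  have dvd: "int L dvd (a + 2 - int i - int p + int L) \<longleftrightarrow> p = p0" if p: "p \<in> {1..L}" for p
  proof -
    have e: "a + 2 - int i - int p + int L = (c div int L + 1) * int L + (c mod int L - (int p - 1))"
    proof -
      have "a + 2 - int i - int p + int L = (c div int L * int L + c mod int L) + 1 - int p + int L"
        unfolding div_mult_mod_eq by (simp add: c_def)
      then show ?thesis by (simp only: distrib_right mult_1_left)
    qed
    have "int L dvd (a + 2 - int i - int p + int L) \<longleftrightarrow> int L dvd (c mod int L - (int p - 1))"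
      unfolding e by (rule dvd_add_right_iff) simp
    also have "\<dots> \<longleftrightarrow> c mod int L - (int p - 1) = 0"
    proof
      assume "int L dvd (c mod int L - (int p - 1))"
      moreover have "\<bar>c mod int L - (int p - 1)\<bar> < int L"
      proof -
        have "1 \<le> int p" "int p \<le> int L" using p by auto
        then show ?thesis using cm by linarith
      qed
      ultimately show "c mod int L - (int p - 1) = 0"
        using dvd_imp_le_int[of "c mod int L - (int p - 1)" "int L"] by linarith
    qed simp
    also have "\<dots> \<longleftrightarrow> p = p0" using cm p by (auto simp: p0_def)
    finally show ?thesis .
  qed
  \<comment> \<open>The offsets -1 of the two grid points add up to 2 = L d, hence the summand
    \<open>int L\<close>.\<close>
  have arg: "of_int a * (2 / real L) - grid L i - grid L p = 2 * of_int (a + 2 - int i - int p + int L) / real L" for p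
  proof -
    have "2 * of_int (a + 2 - int i - int p + int L) / real L = of_int (a + 2 - int i - int p + int L) * d"
      by (simp add: d_def)
    then show ?thesis unfolding grid_def d_def[symmetric] using Ld by (simp add: algebra_simps)
  qed
  have "(\<Sum>p = 1..L. G (grid L p) * (\<Sum>k = - int K..int K. wave k (of_int a * (2 / real L) - grid L i - grid L p)))
      = (\<Sum>p = 1..L. if p = p0 then G (grid L p) * of_nat L else 0)"
  proof (intro sum.cong refl)
    fix p assume p: "p \<in> {1..L}"
    have "(\<Sum>k = - int K..int K. wave k (of_int a * (2 / real L) - grid L i - grid L p))
        = (if p = p0 then of_nat L else 0)"
      unfolding arg using sum_wave[of "a + 2 - int i - int p + int L" K] dvd[OF p] by (simp only: L_def)
    then show "G (grid L p) * (\<Sum>k = - int K..int K. wave k (of_int a * (2 / real L) - grid L i - grid L p))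
        = (if p = p0 then G (grid L p) * of_nat L else 0)" by simp
  qed
  also have "\<dots> = of_nat L * G (grid L p0)" using p0 by simp
  also have "G (grid L p0) = G (of_int a * (2 / real L) - grid L i)"
  proof -
    define s where "s = c div int L + 1"
    have "real_of_int c = real_of_int (c div int L) * real L + real_of_int (c mod int L)"
    proof -
      have "real_of_int c = real_of_int (c div int L * int L + c mod int L)" unfolding div_mult_mod_eq ..
      then show ?thesis by (simp only: of_int_add of_int_mult of_int_of_nat_eq)
    qed
    moreover have "real p0 - 1 = real_of_int (c mod int L)" using cm by (simp add: p0_def)
    ultimately have "real_of_int c = (of_int s - 1) * real L + (real p0 - 1)" by (simp add: s_def)
    moreover have "real_of_int c = of_int a + 1 - real i" by (simp add: c_def)
    ultimately have eq: "of_int a * (2 / real L) - grid L i = grid L p0 + 2 * of_int s"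
      unfolding grid_def d_def[symmetric] using Ld by algebra
    show ?thesis
    proof (cases "s = 0")
      \<comment> \<open>Both points are outside the support: one has modulus below 3/2, the other at
        most 1, and they differ by at least 2.\<close>
      case False
      then have "2 \<le> \<bar>2 * real_of_int s\<bar>" by simp
      moreover have "\<bar>grid L p0\<bar> \<le> 1"
      proof -
        have "(real p0 - 1) * (2 / real L) \<le> real L * (2 / real L)"
          using p0 by (intro mult_right_mono) auto
        moreover have "0 \<le> (real p0 - 1) * (2 / real L)" using p0 by auto
        ultimately show ?thesis using L0 by (simp add: grid_def)
      qed
      ultimately have "\<bar>grid L p0\<bar> \<ge> 1 / 2" "\<bar>of_int a * (2 / real L) - grid L i\<bar> \<ge> 1 / 2"
        using eq i a by linarith+
      then show ?thesis by (simp only: G)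
    qed (use eq in simp)
  qed
  finally show ?thesis .
qed

text \<open>After expansion the frequency sums are taken first. By \<open>periodic_sample\<close>,
  in each coordinate they select the node at which \<open>g\<close> has the value of the true
  convolution integrand.\<close>

lemma trig_conv_lattice:
  fixes K :: nat and a b :: int
  defines "L \<equiv> 2 * K + 1"
  assumes f: "lipschitz_bump B f" and g: "lipschitz_bump B g"
    and a: "\<bar>of_int a * (2 / real L)\<bar> \<le> 1" and b: "\<bar>of_int b * (2 / real L)\<bar> \<le> 1"
  shows "trig_conv K f g (of_int a * (2 / real L), of_int b * (2 / real L)) =
    of_real ((2 / real L)\<^sup>2) * (\<Sum>i = 1..L. \<Sum>j = 1..L. f (grid L i, grid L j) *
      g (of_int a * (2 / real L) - grid L i, of_int b * (2 / real L) - grid L j))"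
proof -
  let ?\<delta> = "2 / real L" and ?I = "{1..L}" and ?Z = "{- int K..int K}"
  let ?a = "of_int a * ?\<delta>" and ?b = "of_int b * ?\<delta>"
  let ?F = "\<lambda>i j. f (grid L i, grid L j)" and ?G = "\<lambda>p q. g (grid L p, grid L q)"
  have summand: "finite_fourier f (k1, k2) L * finite_fourier g (k1, k2) L * plane_wave (k1, k2) (?a, ?b)
      = of_real (?\<delta> ^ 4) * (\<Sum>i\<in>?I. \<Sum>j\<in>?I. \<Sum>p\<in>?I. \<Sum>q\<in>?I. ?F i j * (?G p q *
          wave k1 (?a - grid L i - grid L p) * wave k2 (?b - grid L j - grid L q)))" for k1 k2
  proof -
    have w: "wave k1 (?a - grid L i - grid L p) * wave k2 (?b - grid L j - grid L q) =
      (cnj (wave k1 (grid L i)) * cnj (wave k2 (grid L j))) *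
      ((cnj (wave k1 (grid L p)) * cnj (wave k2 (grid L q))) * plane_wave (k1, k2) (?a, ?b))" for i j p q
      unfolding wave_diff_arg plane_wave_eq by simp
    have \<delta>4: "of_real (?\<delta> ^ 4) = of_real (?\<delta>\<^sup>2) * (of_real (?\<delta>\<^sup>2) :: complex)"
      unfolding of_real_mult[symmetric] by (simp only: power_add[symmetric]) simp
    have expand: "(?F i j * (cnj (wave k1 (grid L i)) * cnj (wave k2 (grid L j)))) *
        ((\<Sum>p\<in>?I. \<Sum>q\<in>?I. ?G p q * (cnj (wave k1 (grid L p)) * cnj (wave k2 (grid L q)))) *
         plane_wave (k1, k2) (?a, ?b))
      = (\<Sum>p\<in>?I. \<Sum>q\<in>?I. ?F i j * (?G p q *
          (wave k1 (?a - grid L i - grid L p) * wave k2 (?b - grid L j - grid L q))))" for i j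
      unfolding w by (simp only: sum_distrib_left sum_distrib_right mult_ac)
    have "finite_fourier f (k1, k2) L * finite_fourier g (k1, k2) L * plane_wave (k1, k2) (?a, ?b)
      = of_real (?\<delta> ^ 4) *
       ((\<Sum>i\<in>?I. \<Sum>j\<in>?I. ?F i j * (cnj (wave k1 (grid L i)) * cnj (wave k2 (grid L j)))) *
        ((\<Sum>p\<in>?I. \<Sum>q\<in>?I. ?G p q * (cnj (wave k1 (grid L p)) * cnj (wave k2 (grid L q)))) *
         plane_wave (k1, k2) (?a, ?b)))"
      unfolding finite_fourier_eq fst_conv snd_conv \<delta>4 by (simp only: mult_ac)
    also have "\<dots> = of_real (?\<delta> ^ 4) * (\<Sum>i\<in>?I. \<Sum>j\<in>?I. (?F i j * (cnj (wave k1 (grid L i)) * cnj (wave k2 (grid L j)))) *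
        ((\<Sum>p\<in>?I. \<Sum>q\<in>?I. ?G p q * (cnj (wave k1 (grid L p)) * cnj (wave k2 (grid L q)))) *
         plane_wave (k1, k2) (?a, ?b)))"
      by (simp only: sum_distrib_right)
    also have "\<dots> = of_real (?\<delta> ^ 4) * (\<Sum>i\<in>?I. \<Sum>j\<in>?I. \<Sum>p\<in>?I. \<Sum>q\<in>?I. ?F i j * (?G p q *
          (wave k1 (?a - grid L i - grid L p) * wave k2 (?b - grid L j - grid L q))))"
      unfolding expand ..
    finally show ?thesis by (simp only: mult.assoc)
  qed
  have inner: "?F i j * (\<Sum>p\<in>?I. \<Sum>q\<in>?I. ?G p q *
       (\<Sum>k1\<in>?Z. wave k1 (?a - grid L i - grid L p)) * (\<Sum>k2\<in>?Z. wave k2 (?b - grid L j - grid L q)))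
      = (of_nat L)\<^sup>2 * (?F i j * g (?a - grid L i, ?b - grid L j))" for i j
  proof (cases "\<bar>grid L i\<bar> < 1 / 2 \<and> \<bar>grid L j\<bar> < 1 / 2")
    \<comment> \<open>Exactly here \<open>periodic_sample\<close> applies in both coordinates; at
      all other nodes \<open>f\<close> vanishes.\<close>
    case True
    have g0: "g (s, t) = 0" if "\<bar>s\<bar> \<ge> 1 / 2 \<or> \<bar>t\<bar> \<ge> 1 / 2" for s t
      using lipschitz_bumpD(3)[OF g that] .
    have "(\<Sum>p\<in>?I. \<Sum>q\<in>?I. ?G p q *
       (\<Sum>k1\<in>?Z. wave k1 (?a - grid L i - grid L p)) * (\<Sum>k2\<in>?Z. wave k2 (?b - grid L j - grid L q)))
      = (\<Sum>q\<in>?I. (\<Sum>p\<in>?I. ?G p q * (\<Sum>k1\<in>?Z. wave k1 (?a - grid L i - grid L p))) *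
          (\<Sum>k2\<in>?Z. wave k2 (?b - grid L j - grid L q)))"
      unfolding sum_distrib_right by (rule sum.swap)
    also have "\<dots> = (\<Sum>q\<in>?I. of_nat L * g (?a - grid L i, grid L q) *
          (\<Sum>k2\<in>?Z. wave k2 (?b - grid L j - grid L q)))"
      unfolding L_def using True a g0
      by (intro sum.cong refl arg_cong2[where f = times] periodic_sample) (simp_all add: L_def)
    also have "\<dots> = of_nat L * (\<Sum>q\<in>?I. g (?a - grid L i, grid L q) *
          (\<Sum>k2\<in>?Z. wave k2 (?b - grid L j - grid L q)))"
      unfolding sum_distrib_left[of "of_nat L"] by (simp only: mult.assoc)
    also have "\<dots> = of_nat L * (of_nat L * g (?a - grid L i, ?b - grid L j))"
      unfolding L_def using True b g0
      by (intro arg_cong2[where f = times] refl periodic_sample) (simp_all add: L_def)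
    finally show ?thesis by (simp add: power2_eq_square)
  next
    case False
    then have "?F i j = 0" using lipschitz_bumpD(3)[OF f] by (auto simp: not_less)
    then show ?thesis by simp
  qed
  have sw: "(\<Sum>k1\<in>?Z. \<Sum>k2\<in>?Z. \<Sum>x\<in>?I. h k1 k2 x) = (\<Sum>x\<in>?I. \<Sum>k1\<in>?Z. \<Sum>k2\<in>?Z. h k1 k2 x)"
    for h :: "int \<Rightarrow> int \<Rightarrow> nat \<Rightarrow> complex"
    by (subst (2) sum.swap) (subst sum.swap, rule refl)
  have sw4: "(\<Sum>k1\<in>?Z. \<Sum>k2\<in>?Z. \<Sum>i\<in>?I. \<Sum>j\<in>?I. \<Sum>p\<in>?I. \<Sum>q\<in>?I. h i j p q k1 k2)
      = (\<Sum>i\<in>?I. \<Sum>j\<in>?I. \<Sum>p\<in>?I. \<Sum>q\<in>?I. \<Sum>k1\<in>?Z. \<Sum>k2\<in>?Z. h i j p q k1 k2)"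
    for h :: "nat \<Rightarrow> nat \<Rightarrow> nat \<Rightarrow> nat \<Rightarrow> int \<Rightarrow> int \<Rightarrow> complex"
    by (simp only: sw)
  have "trig_conv K f g (?a, ?b) = (\<Sum>k1\<in>?Z. \<Sum>k2\<in>?Z. of_real (?\<delta> ^ 4) *
      (\<Sum>i\<in>?I. \<Sum>j\<in>?I. \<Sum>p\<in>?I. \<Sum>q\<in>?I. ?F i j * (?G p q *
          wave k1 (?a - grid L i - grid L p) * wave k2 (?b - grid L j - grid L q)))) / 4"
    unfolding trig_conv_def L_def[symmetric] unfolding summand ..
  also have "\<dots> = of_real (?\<delta> ^ 4) * (\<Sum>k1\<in>?Z. \<Sum>k2\<in>?Z.
      \<Sum>i\<in>?I. \<Sum>j\<in>?I. \<Sum>p\<in>?I. \<Sum>q\<in>?I. ?F i j * (?G p q *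
          wave k1 (?a - grid L i - grid L p) * wave k2 (?b - grid L j - grid L q))) / 4"
    using sum_distrib_left[of "of_real (?\<delta> ^ 4) :: complex" _ ?Z] by (simp only:)
  also have "(\<Sum>k1\<in>?Z. \<Sum>k2\<in>?Z. \<Sum>i\<in>?I. \<Sum>j\<in>?I. \<Sum>p\<in>?I. \<Sum>q\<in>?I. ?F i j * (?G p q *
          wave k1 (?a - grid L i - grid L p) * wave k2 (?b - grid L j - grid L q)))
    = (\<Sum>i\<in>?I. \<Sum>j\<in>?I. \<Sum>p\<in>?I. \<Sum>q\<in>?I. \<Sum>k1\<in>?Z. \<Sum>k2\<in>?Z. ?F i j * (?G p q *
          wave k1 (?a - grid L i - grid L p) * wave k2 (?b - grid L j - grid L q)))"
    by (rule sw4)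
  also have "(\<Sum>i\<in>?I. \<Sum>j\<in>?I. \<Sum>p\<in>?I. \<Sum>q\<in>?I.
      \<Sum>k1\<in>?Z. \<Sum>k2\<in>?Z. ?F i j * (?G p q *
          wave k1 (?a - grid L i - grid L p) * wave k2 (?b - grid L j - grid L q)))
    = (\<Sum>i\<in>?I. \<Sum>j\<in>?I. ?F i j * (\<Sum>p\<in>?I. \<Sum>q\<in>?I. ?G p q *
       (\<Sum>k1\<in>?Z. wave k1 (?a - grid L i - grid L p)) * (\<Sum>k2\<in>?Z. wave k2 (?b - grid L j - grid L q))))"
  proof -
    have "(\<Sum>k1\<in>?Z. \<Sum>k2\<in>?Z. u * (v * s k1 * t k2)) = u * (v * (\<Sum>k1\<in>?Z. s k1) * (\<Sum>k2\<in>?Z. t k2))"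
      for u v :: complex and s t
      unfolding mult.assoc sum_product[of s ?Z t ?Z] unfolding sum_distrib_left ..
    then show ?thesis by (simp only: sum_distrib_left)
  qed
  also have "\<dots> = (of_nat L)\<^sup>2 * (\<Sum>i\<in>?I. \<Sum>j\<in>?I. ?F i j * g (?a - grid L i, ?b - grid L j))"
    unfolding inner by (simp only: sum_distrib_left)
  also have "of_real (?\<delta> ^ 4) * ((of_nat L)\<^sup>2 * S) / 4 = of_real (?\<delta>\<^sup>2) * S" for S :: complex
  proof -
    \<comment> \<open>Each frequency sum contributes a factor \<open>L\<close>, and L times the mesh
      width is 2.\<close>
    have "real L \<noteq> 0" by (simp add: L_def)
    then have "?\<delta> ^ 4 * (real L)\<^sup>2 / 4 = ?\<delta>\<^sup>2" by (simp add: field_simps power2_eq_square power4_eq_xxxx)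
    from arg_cong[OF this, of complex_of_real] show ?thesis by simp
  qed
  finally show ?thesis .
qed

text \<open>Moving a plane wave costs pi |k_i| per coordinate. The weight is put on the transform of
  \<open>f\<close>, so the two square-sum bounds 16 B^2 apply and the constant pi * 16 B^2 / 4 is
  independent of \<open>K\<close>.\<close>

lemma trig_conv_lipschitz:
  assumes f: "lipschitz_bump B f" and g: "lipschitz_bump B g"
  shows "cmod (trig_conv K f g (x, y) - trig_conv K f g (x', y')) \<le> 4 * pi * B\<^sup>2 * (\<bar>x - x'\<bar> + \<bar>y - y'\<bar>)"
proof -
  let ?Z = "{- int K..int K}"
  define F G where "F = (\<lambda>k1 k2. cmod (finite_fourier f (k1, k2) (2 * K + 1)))"
    and "G = (\<lambda>k1 k2. cmod (finite_fourier g (k1, k2) (2 * K + 1)))"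
  define H1 H2 where "H1 = (\<Sum>k1\<in>?Z. \<Sum>k2\<in>?Z. \<bar>of_int k1\<bar> * (F k1 k2 * G k1 k2))"
    and "H2 = (\<Sum>k1\<in>?Z. \<Sum>k2\<in>?Z. \<bar>of_int k2\<bar> * (F k1 k2 * G k1 k2))"
  \<comment> \<open>The arithmetic-geometric mean inequality replaces Cauchy-Schwarz; nothing is
    lost since both square sums have the same bound.\<close>
  have amgm: "u * (s * t) \<le> ((u * s)\<^sup>2 + t\<^sup>2) / 2" for u s t :: real
    using sum_squares_bound[of "u * s" t] by simp
  have mean_sum: "(\<Sum>k1\<in>?Z. \<Sum>k2\<in>?Z. (s k1 k2 + t k1 k2) / 2)
      = ((\<Sum>k1\<in>?Z. \<Sum>k2\<in>?Z. s k1 k2) + (\<Sum>k1\<in>?Z. \<Sum>k2\<in>?Z. t k1 k2)) / 2"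
    for s t :: "int \<Rightarrow> int \<Rightarrow> real"
    by (simp add: sum.distrib sum_divide_distrib add_divide_distrib)
  have mean: "h \<le> c" if "h \<le> (s + t) / 2" "s \<le> c" "t \<le> c" for h s t c :: real
    using that by simp
  have G2: "(\<Sum>k1\<in>?Z. \<Sum>k2\<in>?Z. (G k1 k2)\<^sup>2) \<le> 16 * B\<^sup>2"
    unfolding G_def by (rule finite_fourier_l2[OF g])
  have F1: "(\<Sum>k1\<in>?Z. \<Sum>k2\<in>?Z. (\<bar>of_int k1\<bar> * F k1 k2)\<^sup>2) \<le> 16 * B\<^sup>2"
    unfolding F_def by (rule finite_fourier_h1[OF f])
  \<comment> \<open>The second coordinate is reduced to the first by exchanging the variables of
    \<open>f\<close>.\<close>
  have F2: "(\<Sum>k1\<in>?Z. \<Sum>k2\<in>?Z. (\<bar>of_int k2\<bar> * F k1 k2)\<^sup>2) \<le> 16 * B\<^sup>2"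
    using finite_fourier_h1[OF lipschitz_bump_swap[OF f], of K]
    unfolding F_def finite_fourier_swap by (subst sum.swap) simp
  have "H1 \<le> (\<Sum>k1\<in>?Z. \<Sum>k2\<in>?Z. ((\<bar>of_int k1\<bar> * F k1 k2)\<^sup>2 + (G k1 k2)\<^sup>2) / 2)"
    unfolding H1_def by (rule sum_mono)+ (rule amgm)
  then have "H1 \<le> ((\<Sum>k1\<in>?Z. \<Sum>k2\<in>?Z. (\<bar>of_int k1\<bar> * F k1 k2)\<^sup>2) + (\<Sum>k1\<in>?Z. \<Sum>k2\<in>?Z. (G k1 k2)\<^sup>2)) / 2"
    unfolding mean_sum .
  then have H1: "H1 \<le> 16 * B\<^sup>2" by (rule mean[OF _ F1 G2])
  have "H2 \<le> (\<Sum>k1\<in>?Z. \<Sum>k2\<in>?Z. ((\<bar>of_int k2\<bar> * F k1 k2)\<^sup>2 + (G k1 k2)\<^sup>2) / 2)"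
    unfolding H2_def by (rule sum_mono)+ (rule amgm)
  then have "H2 \<le> ((\<Sum>k1\<in>?Z. \<Sum>k2\<in>?Z. (\<bar>of_int k2\<bar> * F k1 k2)\<^sup>2) + (\<Sum>k1\<in>?Z. \<Sum>k2\<in>?Z. (G k1 k2)\<^sup>2)) / 2"
    unfolding mean_sum .
  then have H2: "H2 \<le> 16 * B\<^sup>2" by (rule mean[OF _ F2 G2])
  have wave: "cmod (plane_wave (k1, k2) (x, y) - plane_wave (k1, k2) (x', y'))
      \<le> pi * \<bar>of_int k1\<bar> * \<bar>x - x'\<bar> + pi * \<bar>of_int k2\<bar> * \<bar>y - y'\<bar>" for k1 k2
  proof -
    have "plane_wave (k1, k2) (x, y) - plane_wave (k1, k2) (x', y')
        = (wave k1 x - wave k1 x') * wave k2 y + wave k1 x' * (wave k2 y - wave k2 y')"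
      by (simp add: plane_wave_eq algebra_simps)
    also have "cmod \<dots> \<le> cmod (wave k1 x - wave k1 x') + cmod (wave k2 y - wave k2 y')"
      by (rule order_trans[OF norm_triangle_ineq]) (simp add: norm_mult)
    finally show ?thesis using norm_wave_diff[of k1 x x'] norm_wave_diff[of k2 y y'] by linarith
  qed
  have split: "(\<Sum>k1\<in>?Z. \<Sum>k2\<in>?Z. F k1 k2 * G k1 k2 *
      (pi * \<bar>of_int k1\<bar> * \<bar>x - x'\<bar> + pi * \<bar>of_int k2\<bar> * \<bar>y - y'\<bar>))
    = pi * \<bar>x - x'\<bar> * H1 + pi * \<bar>y - y'\<bar> * H2"
    unfolding H1_def H2_def sum_distrib_left sum.distrib[symmetric]
    by (intro sum.cong refl) (simp add: algebra_simps)
  have diff: "trig_conv K f g (x, y) - trig_conv K f g (x', y') =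
    (\<Sum>k1\<in>?Z. \<Sum>k2\<in>?Z. finite_fourier f (k1, k2) (2 * K + 1) * finite_fourier g (k1, k2) (2 * K + 1) *
      (plane_wave (k1, k2) (x, y) - plane_wave (k1, k2) (x', y'))) / 4"
    unfolding trig_conv_def by (simp add: sum_subtractf right_diff_distrib diff_divide_distrib)
  have "cmod (trig_conv K f g (x, y) - trig_conv K f g (x', y')) \<le> (\<Sum>k1\<in>?Z. \<Sum>k2\<in>?Z. F k1 k2 * G k1 k2 *
      (pi * \<bar>of_int k1\<bar> * \<bar>x - x'\<bar> + pi * \<bar>of_int k2\<bar> * \<bar>y - y'\<bar>)) / 4"
    unfolding diff norm_divide norm_numeral
    by (intro divide_right_mono sum_norm_le)
      (auto simp: norm_mult F_def G_def intro!: mult_left_mono wave)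
  also have "\<dots> = (pi * \<bar>x - x'\<bar> * H1 + pi * \<bar>y - y'\<bar> * H2) / 4"
    unfolding split ..
  also have "\<dots> \<le> (pi * \<bar>x - x'\<bar> * (16 * B\<^sup>2) + pi * \<bar>y - y'\<bar> * (16 * B\<^sup>2)) / 4"
    by (intro divide_right_mono add_mono mult_left_mono H1 H2) auto
  also have "\<dots> = 4 * pi * B\<^sup>2 * (\<bar>x - x'\<bar> + \<bar>y - y'\<bar>)" by (simp add: algebra_simps)
  finally show ?thesis .
qed

section \<open>Error estimate\<close>

lemma lipschitz_bump_mono:
  assumes "lipschitz_bump B f" "B \<le> C"
  shows "lipschitz_bump C f"
  unfolding lipschitz_bump_def
proof (intro conjI allI impI)
  show "cmod (f x) \<le> C" for x using lipschitz_bumpD(1)[OF assms(1), of x] assms(2) by simp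
  show "cmod (f (x, y) - f (x', y')) \<le> C * (\<bar>x - x'\<bar> + \<bar>y - y'\<bar>)" for x y x' y'
    using lipschitz_bumpD(2)[OF assms(1), of x y x' y']
      mult_right_mono[OF assms(2), of "\<bar>x - x'\<bar> + \<bar>y - y'\<bar>"] by linarith
qed (use lipschitz_bumpD(3)[OF assms(1)] in blast)

lemma continuous_on_lipschitz_bump:
  assumes "lipschitz_bump B f"
  shows "continuous_on S f"
proof -
  have "(2 * B)-lipschitz_on S f"
  proof (rule lipschitz_onI)
    fix u v :: "real \<times> real"
    have "cmod (f u - f v) \<le> B * (\<bar>fst u - fst v\<bar> + \<bar>snd u - snd v\<bar>)"
      using lipschitz_bumpD(2)[OF assms, of "fst u" "snd u" "fst v" "snd v"] by simp
    also have "\<dots> \<le> B * (dist u v + dist u v)"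
      using lipschitz_bumpD(4)[OF assms] dist_fst_le[of u v] dist_snd_le[of u v]
      by (intro mult_left_mono add_mono) (auto simp: dist_real_def)
    finally show "dist (f u) (f v) \<le> 2 * B * dist u v" by (simp add: dist_norm algebra_simps)
  qed (use lipschitz_bumpD(4)[OF assms] in simp)
  then show ?thesis by (rule lipschitz_on_continuous_on)
qed

text \<open>The function and its partial derivatives are continuous and vanish off a compact ball,
  hence are bounded. The mean value inequality is applied along two axis-parallel segments joining
  the points.\<close>

lemma C1_plane_imp_lipschitz_bump:
  assumes f: "C1_plane f" and supp: "supp f \<subseteq> ball 0 (1 / 2)"
  obtains B where "B > 0" "lipschitz_bump B f"
proof -
  obtain f1 f2 where c: "continuous_on UNIV f" "continuous_on UNIV f1" "continuous_on UNIV f2"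
    and d1: "\<And>x y. ((\<lambda>t. f (t, y)) has_vector_derivative f1 (x, y)) (at x)"
    and d2: "\<And>x y. ((\<lambda>t. f (x, t)) has_vector_derivative f2 (x, y)) (at y)"
    using f unfolding C1_plane_def by blast
  have f0: "f p = 0" if "norm p \<ge> 1 / 2" for p
  proof -
    have "p \<notin> ball 0 (1 / 2)" using that by simp
    then show ?thesis using supp unfolding supp_def by blast
  qed
  \<comment> \<open>The strict inequality gives an open set, on which \<open>f\<close> is locally
    zero; the sphere itself belongs to the compact ball.\<close>
  have f10: "f1 (x, y) = 0" if "norm (x, y) > 1 / 2" for x y
  proof -
    have "open {t. norm (t, y) > 1 / 2}" by (intro open_Collect_less continuous_intros)
    then have "((\<lambda>t. f (t, y)) has_vector_derivative 0) (at x)"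
      using that f0 by (intro has_vector_derivative_transform_within_open[OF has_vector_derivative_const]) auto
    then show ?thesis using d1 vector_derivative_unique_at by blast
  qed
  have f20: "f2 (x, y) = 0" if "norm (x, y) > 1 / 2" for x y
  proof -
    have "open {t. norm (x, t) > 1 / 2}" by (intro open_Collect_less continuous_intros)
    then have "((\<lambda>t. f (x, t)) has_vector_derivative 0) (at y)"
      using that f0 by (intro has_vector_derivative_transform_within_open[OF has_vector_derivative_const]) auto
    then show ?thesis using d2 vector_derivative_unique_at by blast
  qed
  have bdd: "\<exists>B>0. \<forall>p. cmod (\<phi> p) \<le> B"
    if "continuous_on UNIV \<phi>" "\<And>x y. norm (x, y) > 1 / 2 \<Longrightarrow> \<phi> (x, y) = 0" for \<phi> :: "real \<times> real \<Rightarrow> complex"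
  proof -
    have "compact (\<phi> ` cball 0 (1 / 2))"
      using that(1) continuous_on_subset by (intro compact_continuous_image) (blast, rule compact_cball)
    then have "bounded (\<phi> ` cball 0 (1 / 2))" by (rule compact_imp_bounded)
    then obtain B where B: "B > 0" "\<forall>z \<in> \<phi> ` cball 0 (1 / 2). cmod z \<le> B"
      unfolding bounded_pos by blast
    have "cmod (\<phi> p) \<le> B" for p
    proof (cases "norm p > 1 / 2")
      case True
      then have "\<phi> p = 0" using that(2)[of "fst p" "snd p"] by simp
      then show ?thesis using B(1) by simp
    next
      case False
      then have "p \<in> cball 0 (1 / 2)" by simp
      then show ?thesis using B(2) by blast
    qed
    then show ?thesis using B(1) by blast
  qed
  obtain B0 where B0: "B0 > 0" "\<forall>p. cmod (f p) \<le> B0" using bdd[OF c(1)] f0 by auto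
  obtain B1 where B1: "B1 > 0" "\<forall>p. cmod (f1 p) \<le> B1" using bdd[OF c(2) f10] by auto
  obtain B2 where B2: "B2 > 0" "\<forall>p. cmod (f2 p) \<le> B2" using bdd[OF c(3) f20] by auto
  have mvt: "cmod (\<phi> s - \<phi> t) \<le> C * \<bar>s - t\<bar>"
    if "\<And>t. (\<phi> has_vector_derivative \<phi>' t) (at t)" "\<And>t. cmod (\<phi>' t) \<le> C"
    for \<phi> \<phi>' :: "real \<Rightarrow> complex" and s t C
  proof -
    have "norm (\<phi> s - \<phi> t) \<le> C * norm (s - t)"
    proof (rule differentiable_bound[where S = UNIV and f' = "\<lambda>t h. h *\<^sub>R \<phi>' t"])
      show "(\<phi> has_derivative (\<lambda>h. h *\<^sub>R \<phi>' t)) (at t within UNIV)" for t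
        using that(1) by (simp add: has_vector_derivative_def)
      show "onorm (\<lambda>h. h *\<^sub>R \<phi>' t) \<le> C" for t
      proof (rule onorm_le)
        fix h :: real
        show "norm (h *\<^sub>R \<phi>' t) \<le> C * norm h"
          using mult_right_mono[OF that(2)[of t], of "\<bar>h\<bar>"] by (simp add: mult.commute)
      qed
    qed auto
    then show ?thesis by simp
  qed
  define B where "B = B0 + B1 + B2"
  show thesis
  proof (rule that[of B])
    show "B > 0" using B0 B1 B2 by (simp add: B_def)
    show "lipschitz_bump B f"
      unfolding lipschitz_bump_def
    proof (intro conjI allI impI)
      show "cmod (f p) \<le> B" for p
      proof -
        have "cmod (f p) \<le> B0" using B0(2) by blast
        then show ?thesis using B1(1) B2(1) unfolding B_def by linarith
      qed
      fix x y x' y' :: real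
      have "cmod (f (x, y) - f (x', y)) \<le> B1 * \<bar>x - x'\<bar>"
        by (rule mvt[where \<phi> = "\<lambda>t. f (t, y)", OF d1]) (use B1 in blast)
      moreover have "cmod (f (x', y) - f (x', y')) \<le> B2 * \<bar>y - y'\<bar>"
        by (rule mvt[where \<phi> = "\<lambda>t. f (x', t)", OF d2]) (use B2 in blast)
      moreover have "B1 * \<bar>x - x'\<bar> \<le> B * \<bar>x - x'\<bar>" "B2 * \<bar>y - y'\<bar> \<le> B * \<bar>y - y'\<bar>"
        using B0(1) B1(1) B2(1) by (auto simp: B_def intro!: mult_right_mono)
      moreover have "cmod (f (x, y) - f (x', y')) \<le> cmod (f (x, y) - f (x', y)) + cmod (f (x', y) - f (x', y'))"
        using norm_triangle_ineq[of "f (x, y) - f (x', y)" "f (x', y) - f (x', y')"] by simp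
      ultimately show "cmod (f (x, y) - f (x', y')) \<le> B * (\<bar>x - x'\<bar> + \<bar>y - y'\<bar>)"
        unfolding distrib_left by linarith
    next
      fix x y :: real
      assume "\<bar>x\<bar> \<ge> 1 / 2 \<or> \<bar>y\<bar> \<ge> 1 / 2"
      moreover have "\<bar>x\<bar> \<le> norm (x, y)" "\<bar>y\<bar> \<le> norm (x, y)"
        using norm_fst_le[of x y] norm_snd_le[of y x] by simp_all
      ultimately show "f (x, y) = 0" by (intro f0) linarith
    qed
  qed
qed

section \<open>Riemann sums over the square\<close>

definition unit_square :: "(real \<times> real) set" where
  "unit_square = cbox (- 1, - 1) (1, 1)"

lemma mem_unit_square: "(x, y) \<in> unit_square \<longleftrightarrow> \<bar>x\<bar> \<le> 1 \<and> \<bar>y\<bar> \<le> 1"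
  by (auto simp: unit_square_def abs_le_iff)

lemma integrable_on_unit_square:
  fixes F :: "real \<times> real \<Rightarrow> complex"
  assumes "continuous_on UNIV F" "\<And>y. y \<notin> unit_square \<Longrightarrow> F y = 0"
  shows "integrable lborel F"
proof -
  have "integrable lborel (\<lambda>x. indicator unit_square x *\<^sub>R F x)"
    unfolding unit_square_def
    by (rule borel_integrable_compact) (auto intro: continuous_on_subset[OF assms(1)])
  moreover have "(\<lambda>x. indicator unit_square x *\<^sub>R F x) = F"
    using assms(2) by (auto simp: indicator_def)
  ultimately show ?thesis by simp
qed

lemma norm_integral_unit_square_le:
  fixes F :: "real \<times> real \<Rightarrow> complex"
  assumes F: "integrable lborel F" and 0: "\<And>y. y \<notin> unit_square \<Longrightarrow> F y = 0" and le: "\<And>y. cmod (F y) \<le> c"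
  shows "cmod (LINT y|lborel. F y) \<le> 4 * c"
proof -
  have m: "measure lborel unit_square = 4" unfolding unit_square_def by (simp add: content_Pair)
  have i: "integrable lborel (\<lambda>y. indicator unit_square y * c)"
    unfolding unit_square_def by (intro integrable_mult_left integrable_real_indicator) (auto simp: emeasure_lborel_cbox_eq)
  have "cmod (LINT y|lborel. F y) \<le> (LINT y|lborel. cmod (F y))" by (rule integral_norm_bound)
  also have "\<dots> \<le> (LINT y|lborel. indicator unit_square y * c)"
    using F i 0 le by (intro integral_mono) (auto simp: indicator_def)
  also have "\<dots> = 4 * c" by (simp add: m)
  finally show ?thesis .
qed

text \<open>The half-open cells tile [-1, 1), so each point lies in exactly one. Its index is one
  more than the integer part of (y + 1) L / 2, the position counted in cells from -1.\<close>

lemma grid_cell: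
  fixes L :: nat and y :: real
  assumes L: "L > 0" and y: "- 1 \<le> y" "y < 1"
  obtains i0 where "i0 \<in> {1..L}" "\<bar>y - grid L i0\<bar> \<le> 2 / real L"
    "\<And>i. i \<in> {1..L} \<Longrightarrow> y \<in> {grid L i..<grid L i + 2 / real L} \<longleftrightarrow> i = i0"
proof -
  define t where "t = (y + 1) * real L / 2"
  define i0 where "i0 = Suc (nat \<lfloor>t\<rfloor>)"
  have t: "0 \<le> t" "t < real L"
  proof -
    have "(y + 1) * real L < 2 * real L" using y L by (intro mult_strict_right_mono) auto
    then show "t < real L" by (simp add: t_def)
    show "0 \<le> t" using y by (simp add: t_def)
  qed
  have cell: "y \<in> {grid L i..<grid L i + 2 / real L} \<longleftrightarrow> real i - 1 \<le> t \<and> t < real i" for i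
    using L by (simp add: grid_def t_def field_simps)
  have fl: "i = i0 \<longleftrightarrow> real i - 1 \<le> t \<and> t < real i" if "i \<ge> 1" for i
  proof -
    have "i = i0 \<longleftrightarrow> \<lfloor>t\<rfloor> = int i - 1" using that t by (auto simp: i0_def)
    also have "\<dots> \<longleftrightarrow> real i - 1 \<le> t \<and> t < real i" by (auto simp: floor_eq_iff)
    finally show ?thesis .
  qed
  have i0: "i0 \<in> {1..L}" using t unfolding i0_def by (simp add: nat_less_iff floor_less_iff Suc_le_eq)
  show thesis
  proof (rule that[OF i0])
    have "y \<in> {grid L i0..<grid L i0 + 2 / real L}" using cell fl[of i0] i0 by auto
    then show "\<bar>y - grid L i0\<bar> \<le> 2 / real L" by auto
  qed (use cell fl in auto)
qed

text \<open>The Riemann sum is the integral of the step function \<open>S\<close> with the nodal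
  values of \<open>F\<close>. Within a cell both coordinates move by at most one mesh width, so |S -
  F| is at most 2 M \<delta>, and the square has area 4.\<close>

lemma riemann_sum_error:
  fixes F :: "real \<times> real \<Rightarrow> complex" and L :: nat
  assumes L: "L > 0" and c: "continuous_on UNIV F"
    and 0: "\<And>x y. \<bar>x\<bar> \<ge> 1 / 2 \<or> \<bar>y\<bar> \<ge> 1 / 2 \<Longrightarrow> F (x, y) = 0"
    and lip: "\<And>x y x' y'. cmod (F (x, y) - F (x', y')) \<le> M * (\<bar>x - x'\<bar> + \<bar>y - y'\<bar>)" and M: "M \<ge> 0"
  shows "cmod (of_real ((2 / real L)\<^sup>2) * (\<Sum>i = 1..L. \<Sum>j = 1..L. F (grid L i, grid L j)) - (LINT y|lborel. F y))
    \<le> 8 * M * (2 / real L)"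
proof -
  define \<delta> where "\<delta> = 2 / real L"
  have \<delta>: "\<delta> > 0" using L by (simp add: \<delta>_def)
  define C where "C = (\<lambda>i. {grid L i..<grid L i + \<delta>})"
  define S where "S = (\<lambda>y. \<Sum>i = 1..L. \<Sum>j = 1..L. indicator (C i \<times> C j) y *\<^sub>R F (grid L i, grid L j))"
  have meas: "C i \<times> C j \<in> sets lborel" "emeasure lborel (C i \<times> C j) = ennreal (\<delta>\<^sup>2)" for i j
  proof -
    have "C i \<times> C j \<in> sets (lborel \<Otimes>\<^sub>M lborel)" unfolding C_def by (intro pair_measureI) auto
    then show "C i \<times> C j \<in> sets lborel" unfolding lborel_prod .
    have "emeasure (lborel \<Otimes>\<^sub>M lborel) (C i \<times> C j) = emeasure lborel (C i) * emeasure lborel (C j)"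
      by (rule lborel.emeasure_pair_measure_Times) (auto simp: C_def)
    also have "\<dots> = ennreal (\<delta>\<^sup>2)"
      unfolding C_def using \<delta> by (simp add: ennreal_mult[symmetric] power2_eq_square)
    finally show "emeasure lborel (C i \<times> C j) = ennreal (\<delta>\<^sup>2)" unfolding lborel_prod .
  qed
  have ind: "has_bochner_integral lborel (\<lambda>y. indicator (C i \<times> C j) y *\<^sub>R v) (\<delta>\<^sup>2 *\<^sub>R v)" for i j and v :: complex
    using has_bochner_integral_indicator[of "C i \<times> C j" lborel v] meas[of i j]
    by (simp add: measure_def)
  have S: "has_bochner_integral lborel S (\<Sum>i = 1..L. \<Sum>j = 1..L. \<delta>\<^sup>2 *\<^sub>R F (grid L i, grid L j))"
    unfolding S_def by (intro has_bochner_integral_sum ind)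
  have intF: "integrable lborel F"
  proof (rule integrable_on_unit_square[OF c])
    fix y assume "y \<notin> unit_square"
    then show "F y = 0" by (cases y) (use 0 in \<open>auto simp: mem_unit_square\<close>)
  qed
  have out: "indicator (C i) y = (0 :: real)" if "y < - 1 \<or> 1 \<le> y" "i \<in> {1..L}" for i y
  proof -
    have "(real i - 1) * \<delta> + \<delta> \<le> real L * \<delta>"
      using that(2) \<delta> mult_right_mono[of "real i" "real L" \<delta>] by (simp add: algebra_simps)
    moreover have "real L * \<delta> = 2" using L by (simp add: \<delta>_def)
    moreover have "0 \<le> (real i - 1) * \<delta>" using that(2) \<delta> by auto
    ultimately have "- 1 \<le> grid L i" "grid L i + \<delta> \<le> 1"
      unfolding grid_def \<delta>_def[symmetric] by linarith+
    then show ?thesis using that(1) by (auto simp: C_def indicator_def)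
  qed
  \<comment> \<open>Half-open cells miss the right and upper edges of the square; \<open>F\<close>
    vanishes there too.\<close>
  have S_out: "S (x, y) = 0" if "x < - 1 \<or> 1 \<le> x \<or> y < - 1 \<or> 1 \<le> y" for x y
    unfolding S_def indicator_times using that out by (intro sum.neutral ballI) auto
  have diff: "cmod (S (x, y) - F (x, y)) \<le> 2 * M * \<delta>" for x y
  proof (cases "x < - 1 \<or> 1 \<le> x \<or> y < - 1 \<or> 1 \<le> y")
    case True
    then have "F (x, y) = 0" by (intro 0) auto
    then show ?thesis using S_out[OF True] M \<delta> by simp
  next
    case False
    then have xy: "- 1 \<le> x" "x < 1" "- 1 \<le> y" "y < 1" by auto
    obtain i0 where i0: "i0 \<in> {1..L}" "\<bar>x - grid L i0\<bar> \<le> \<delta>" "\<And>i. i \<in> {1..L} \<Longrightarrow> x \<in> C i \<longleftrightarrow> i = i0"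
      using grid_cell[OF L xy(1,2)] unfolding C_def \<delta>_def by blast
    obtain j0 where j0: "j0 \<in> {1..L}" "\<bar>y - grid L j0\<bar> \<le> \<delta>" "\<And>i. i \<in> {1..L} \<Longrightarrow> y \<in> C i \<longleftrightarrow> i = j0"
      using grid_cell[OF L xy(3,4)] unfolding C_def \<delta>_def by blast
    have "S (x, y) = (\<Sum>i = 1..L. \<Sum>j = 1..L. if j = j0 then (if i = i0 then F (grid L i, grid L j) else 0) else 0)"
      unfolding S_def indicator_times using i0(3) j0(3) by (intro sum.cong refl) (auto simp: indicator_def)
    also have "\<dots> = F (grid L i0, grid L j0)" using i0(1) j0(1) by simp
    finally have "cmod (S (x, y) - F (x, y)) \<le> M * (\<bar>grid L i0 - x\<bar> + \<bar>grid L j0 - y\<bar>)"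
      using lip by simp
    also have "\<dots> \<le> M * (\<delta> + \<delta>)"
      using i0(2) j0(2) M by (intro mult_left_mono add_mono) (auto simp: abs_minus_commute)
    finally show ?thesis by simp
  qed
  have "cmod (LINT y|lborel. S y - F y) \<le> 4 * (2 * M * \<delta>)"
  proof (rule norm_integral_unit_square_le)
    show "integrable lborel (\<lambda>y. S y - F y)"
      using S intF by (intro Bochner_Integration.integrable_diff) (auto simp: has_bochner_integral_iff)
    show "cmod (S y - F y) \<le> 2 * M * \<delta>" for y using diff[of "fst y" "snd y"] by simp
    fix p assume p: "p \<notin> unit_square"
    obtain x y where "p = (x, y)" by (cases p)
    with p have "\<bar>x\<bar> > 1 \<or> \<bar>y\<bar> > 1" by (auto simp: mem_unit_square)
    then have "S (x, y) = 0" "F (x, y) = 0" by (intro S_out 0; auto)+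
    then show "S p - F p = 0" using \<open>p = (x, y)\<close> by simp
  qed
  moreover have "(LINT y|lborel. S y - F y) = (LINT y|lborel. S y) - (LINT y|lborel. F y)"
    using S intF by (intro Bochner_Integration.integral_diff) (auto simp: has_bochner_integral_iff)
  moreover have "(LINT y|lborel. S y) = of_real (\<delta>\<^sup>2) * (\<Sum>i = 1..L. \<Sum>j = 1..L. F (grid L i, grid L j))"
    using S by (simp add: has_bochner_integral_iff scaleR_conv_of_real sum_distrib_left)
  ultimately show ?thesis unfolding \<delta>_def[symmetric] by (simp add: mult.assoc)
qed

text \<open>Rounding towards 0 keeps the lattice point inside [-1, 1], as the evaluation of
  \<open>trig_conv\<close> at lattice points demands.\<close>

lemma lattice_round:
  fixes x \<delta> :: real
  assumes "\<bar>x\<bar> \<le> 1" "\<delta> > 0"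
  obtains a :: int where "\<bar>of_int a * \<delta>\<bar> \<le> 1" "\<bar>x - of_int a * \<delta>\<bar> \<le> \<delta>"
proof -
  have *: "\<exists>a::int. \<bar>of_int a * \<delta>\<bar> \<le> 1 \<and> \<bar>x - of_int a * \<delta>\<bar> \<le> \<delta>" if "0 \<le> x" "x \<le> 1" for x
  proof (intro exI conjI)
    have "of_int \<lfloor>x / \<delta>\<rfloor> * \<delta> \<le> x"
      unfolding pos_le_divide_eq[OF assms(2), symmetric] by (rule of_int_floor_le)
    moreover have "x < (of_int \<lfloor>x / \<delta>\<rfloor> + 1) * \<delta>"
      unfolding pos_divide_less_eq[OF assms(2), symmetric] by linarith
    then have "x < of_int \<lfloor>x / \<delta>\<rfloor> * \<delta> + \<delta>" by (simp only: distrib_right mult_1_left)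
    moreover have "0 \<le> of_int \<lfloor>x / \<delta>\<rfloor> * \<delta>" using that assms(2) by simp
    ultimately show "\<bar>of_int \<lfloor>x / \<delta>\<rfloor> * \<delta>\<bar> \<le> 1" "\<bar>x - of_int \<lfloor>x / \<delta>\<rfloor> * \<delta>\<bar> \<le> \<delta>" using that by linarith+
  qed
  show thesis
  proof (cases "0 \<le> x")
    case True
    then show thesis using *[of x] assms(1) that by auto
  next
    case False
    then obtain a :: int where "\<bar>of_int a * \<delta>\<bar> \<le> 1" "\<bar>- x - of_int a * \<delta>\<bar> \<le> \<delta>"
      using *[of "- x"] assms(1) by auto
    then show thesis using that[of "- a"] by (simp add: abs_minus_commute)
  qed
qed

section \<open>Convolution of two Lipschitz functions and its approximation\<close>

context
  fixes B f g
  assumes f: "lipschitz_bump B f" and g: "lipschitz_bump B g"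
begin

lemma conv_integrand:
  shows "continuous_on UNIV (\<lambda>y. f y * g (x - y))"
    and "y \<notin> unit_square \<Longrightarrow> f y * g (x - y) = 0"
    and "integrable lborel (\<lambda>y. f y * g (x - y))"
proof -
  show c: "continuous_on UNIV (\<lambda>y. f y * g (x - y))"
    by (intro continuous_intros continuous_on_lipschitz_bump[OF f]
        continuous_on_compose2[OF continuous_on_lipschitz_bump[OF g, of UNIV]]) auto
  show 0: "f y * g (x - y) = 0" if "y \<notin> unit_square" for y
    using that lipschitz_bumpD(3)[OF f, of "fst y" "snd y"] by (cases y) (auto simp: mem_unit_square)
  show "integrable lborel (\<lambda>y. f y * g (x - y))"
    by (rule integrable_on_unit_square[OF c 0])
qed

lemma plane_conv_lipschitz:
  "cmod (plane_conv f g (x, y) - plane_conv f g (x', y')) \<le> 4 * B\<^sup>2 * (\<bar>x - x'\<bar> + \<bar>y - y'\<bar>)"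
proof -
  have "plane_conv f g (x, y) - plane_conv f g (x', y')
      = (LINT p|lborel. f p * g ((x, y) - p) - f p * g ((x', y') - p))"
    unfolding plane_conv_def by (intro Bochner_Integration.integral_diff[symmetric] conv_integrand)
  also have "cmod \<dots> \<le> 4 * (B * (B * (\<bar>x - x'\<bar> + \<bar>y - y'\<bar>)))"
  proof (rule norm_integral_unit_square_le)
    show "integrable lborel (\<lambda>p. f p * g ((x, y) - p) - f p * g ((x', y') - p))"
      by (intro Bochner_Integration.integrable_diff conv_integrand)
    show "f p * g ((x, y) - p) - f p * g ((x', y') - p) = 0" if "p \<notin> unit_square" for p
      unfolding conv_integrand(2)[OF that] by simp
    show "cmod (f p * g ((x, y) - p) - f p * g ((x', y') - p)) \<le> B * (B * (\<bar>x - x'\<bar> + \<bar>y - y'\<bar>))" for p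
    proof -
      have "cmod (g ((x, y) - p) - g ((x', y') - p)) \<le> B * (\<bar>x - x'\<bar> + \<bar>y - y'\<bar>)"
        using lipschitz_bumpD(2)[OF g, of "x - fst p" "y - snd p" "x' - fst p" "y' - snd p"] by (cases p) simp
      then show ?thesis
        unfolding right_diff_distrib[symmetric] norm_mult
        using lipschitz_bumpD(1,4)[OF f] by (intro mult_mono) auto
    qed
  qed
  finally show ?thesis by (simp add: power2_eq_square mult.assoc)
qed

text \<open>The integrand is a product of two functions that are bounded by \<open>B\<close> and
  Lipschitz with constant \<open>B\<close>, so its Lipschitz constant is 2 B^2 and the quadrature
  bound 8 M becomes 16 B^2.\<close>

lemma plane_conv_riemann:
  assumes "L > 0"
  shows "cmod (of_real ((2 / real L)\<^sup>2) * (\<Sum>i = 1..L. \<Sum>j = 1..L. f (grid L i, grid L j) *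
      g (a - grid L i, b - grid L j)) - plane_conv f g (a, b)) \<le> 16 * B\<^sup>2 * (2 / real L)"
proof -
  let ?F = "\<lambda>p. f p * g ((a, b) - p)"
  have "cmod (of_real ((2 / real L)\<^sup>2) * (\<Sum>i = 1..L. \<Sum>j = 1..L. ?F (grid L i, grid L j)) - (LINT y|lborel. ?F y))
      \<le> 8 * (2 * B\<^sup>2) * (2 / real L)"
  proof (rule riemann_sum_error[OF assms conv_integrand(1)])
    show "?F (x, y) = 0" if "\<bar>x\<bar> \<ge> 1 / 2 \<or> \<bar>y\<bar> \<ge> 1 / 2" for x y
      using lipschitz_bumpD(3)[OF f that] by simp
    show "cmod (?F (x, y) - ?F (x', y')) \<le> 2 * B\<^sup>2 * (\<bar>x - x'\<bar> + \<bar>y - y'\<bar>)" for x y x' y'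
    proof -
      let ?d = "\<bar>x - x'\<bar> + \<bar>y - y'\<bar>"
      have "?F (x, y) - ?F (x', y') = (f (x, y) - f (x', y')) * g (a - x, b - y)
          + f (x', y') * (g (a - x, b - y) - g (a - x', b - y'))"
        by (simp add: algebra_simps)
      also have "cmod \<dots> \<le> cmod (f (x, y) - f (x', y')) * cmod (g (a - x, b - y))
          + cmod (f (x', y')) * cmod (g (a - x, b - y) - g (a - x', b - y'))"
        by (rule order_trans[OF norm_triangle_ineq]) (simp add: norm_mult)
      also have "\<dots> \<le> (B * ?d) * B + B * (B * ?d)"
      proof (intro add_mono mult_mono)
        show "cmod (g (a - x, b - y) - g (a - x', b - y')) \<le> B * ?d"
          using lipschitz_bumpD(2)[OF g, of "a - x" "b - y" "a - x'" "b - y'"] by (simp add: abs_minus_commute)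
      qed (use lipschitz_bumpD[OF f] lipschitz_bumpD(1)[OF g] in auto)
      finally show ?thesis by (simp add: power2_eq_square algebra_simps)
    qed
  qed simp
  then show ?thesis by (simp add: plane_conv_def)
qed

text \<open>Three errors of order \<delta> are added: the move of \<open>trig_conv\<close> to a
  lattice point (8 pi B^2), the quadrature there (16 B^2), and the move of the convolution back (8
  B^2). Finally \<delta> = 2 / (2 K + 1) <= 1 / K.\<close>

lemma trig_conv_error:
  assumes K: "K \<ge> 1" and x: "\<bar>x\<bar> \<le> 1" and y: "\<bar>y\<bar> \<le> 1"
  shows "cmod (trig_conv K f g (x, y) - plane_conv f g (x, y)) \<le> (8 * pi + 24) * B\<^sup>2 / real K"
proof -
  define L where "L = 2 * K + 1"
  define \<delta> where "\<delta> = 2 / real L"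
  have \<delta>: "\<delta> > 0" by (simp add: \<delta>_def L_def)
  obtain a where a: "\<bar>of_int a * \<delta>\<bar> \<le> 1" "\<bar>x - of_int a * \<delta>\<bar> \<le> \<delta>" using lattice_round[OF x \<delta>] .
  obtain b where b: "\<bar>of_int b * \<delta>\<bar> \<le> 1" "\<bar>y - of_int b * \<delta>\<bar> \<le> \<delta>" using lattice_round[OF y \<delta>] .
  let ?w = "(of_int a * \<delta>, of_int b * \<delta>)"
  have d: "\<bar>x - of_int a * \<delta>\<bar> + \<bar>y - of_int b * \<delta>\<bar> \<le> 2 * \<delta>" using a b by simp
  have "cmod (trig_conv K f g (x, y) - trig_conv K f g ?w)
      \<le> 4 * pi * B\<^sup>2 * (\<bar>x - of_int a * \<delta>\<bar> + \<bar>y - of_int b * \<delta>\<bar>)"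
    by (rule trig_conv_lipschitz[OF f g])
  also have "\<dots> \<le> 4 * pi * B\<^sup>2 * (2 * \<delta>)" by (intro mult_left_mono d) simp
  finally have 1: "cmod (trig_conv K f g (x, y) - trig_conv K f g ?w) \<le> 4 * pi * B\<^sup>2 * (2 * \<delta>)" .
  have 2: "cmod (trig_conv K f g ?w - plane_conv f g ?w) \<le> 16 * B\<^sup>2 * \<delta>"
    using plane_conv_riemann[of L "of_int a * \<delta>" "of_int b * \<delta>"] trig_conv_lattice[OF f g, of a K b] a(1) b(1)
    by (simp add: L_def \<delta>_def)
  have "cmod (plane_conv f g (x, y) - plane_conv f g ?w)
      \<le> 4 * B\<^sup>2 * (\<bar>x - of_int a * \<delta>\<bar> + \<bar>y - of_int b * \<delta>\<bar>)"
    by (rule plane_conv_lipschitz)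
  also have "\<dots> \<le> 4 * B\<^sup>2 * (2 * \<delta>)" by (intro mult_left_mono d) simp
  finally have 3: "cmod (plane_conv f g ?w - plane_conv f g (x, y)) \<le> 4 * B\<^sup>2 * (2 * \<delta>)"
    by (simp add: norm_minus_commute)
  have "trig_conv K f g (x, y) - plane_conv f g (x, y) = (trig_conv K f g (x, y) - trig_conv K f g ?w)
      + (trig_conv K f g ?w - plane_conv f g ?w) + (plane_conv f g ?w - plane_conv f g (x, y))" by simp
  then have "cmod (trig_conv K f g (x, y) - plane_conv f g (x, y))
      \<le> 4 * pi * B\<^sup>2 * (2 * \<delta>) + 16 * B\<^sup>2 * \<delta> + 4 * B\<^sup>2 * (2 * \<delta>)"
    using norm_triangle_mono[OF norm_triangle_mono[OF 1 2] 3] by simp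
  also have "\<dots> = (8 * pi + 24) * B\<^sup>2 * \<delta>" by (simp add: algebra_simps)
  also have "\<dots> \<le> (8 * pi + 24) * B\<^sup>2 * (1 / real K)"
    using K by (intro mult_left_mono) (auto simp: \<delta>_def L_def field_simps)
  finally show ?thesis by simp
qed

lemma continuous_on_plane_conv: "continuous_on S (plane_conv f g)"
proof -
  have "(2 * (4 * B\<^sup>2))-lipschitz_on S (plane_conv f g)"
  proof (rule lipschitz_onI)
    fix u v :: "real \<times> real"
    have "cmod (plane_conv f g u - plane_conv f g v) \<le> 4 * B\<^sup>2 * (\<bar>fst u - fst v\<bar> + \<bar>snd u - snd v\<bar>)"
      using plane_conv_lipschitz[of "fst u" "snd u" "fst v" "snd v"] by simp
    also have "\<dots> \<le> 4 * B\<^sup>2 * (dist u v + dist u v)"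
      using dist_fst_le[of u v] dist_snd_le[of u v]
      by (intro mult_left_mono add_mono) (auto simp: dist_real_def)
    finally show "dist (plane_conv f g u) (plane_conv f g v) \<le> 2 * (4 * B\<^sup>2) * dist u v"
      by (simp add: dist_norm)
  qed simp
  then show ?thesis by (rule lipschitz_on_continuous_on)
qed

end

theorem theorem5p3:
  "\<exists>(\<gamma> :: int \<Rightarrow> nat \<Rightarrow> real)
     (d :: (real \<times> real \<Rightarrow> complex) \<Rightarrow> (real \<times> real \<Rightarrow> complex) \<Rightarrow> real).
    \<forall>(m :: int) (n :: nat) (f :: real \<times> real \<Rightarrow> complex) (g :: real \<times> real \<Rightarrow> complex).
      n \<ge> 1 \<and> C1_plane f \<and> C1_plane g \<and>
      supp f \<subseteq> ball 0 (1 / 2) \<and> supp g \<subseteq> ball 0 (1 / 2) \<longrightarrow>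
      \<gamma> m n > 0 \<and> d f g > 0 \<and>
      (\<forall>K :: nat. K \<ge> 1 \<and> int K \<ge> K_min m n \<longrightarrow>
        cmod (FB_approx K m n f g - FB_coeff m n (plane_conv f g)) \<le> 2 * \<gamma> m n * d f g / real K)"
proof -
  define good where "good = (\<lambda>f. C1_plane f \<and> supp f \<subseteq> ball 0 (1 / 2))"
  define P where "P = (\<lambda>m n M. M > 0 \<and> (\<forall>u v E. continuous_on UNIV u \<longrightarrow> continuous_on UNIV v \<longrightarrow>
      (\<forall>x y. \<bar>x\<bar> \<le> 1 \<longrightarrow> \<bar>y\<bar> \<le> 1 \<longrightarrow> cmod (u (x, y) - v (x, y)) \<le> E) \<longrightarrow>
      cmod (FB_coeff m n u - FB_coeff m n v) \<le> M * E))"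
  \<comment> \<open>The choice is made before \<open>f\<close> and \<open>g\<close> appear, so the
    constant depends on \<open>m\<close> and \<open>n\<close> alone; \<open>D\<close> is chosen
    likewise from \<open>f\<close> and \<open>g\<close>.\<close>
  have "\<forall>m n. \<exists>M. P m n M"
  proof (intro allI)
    fix m n
    show "\<exists>M. P m n M" using FB_coeff_bound[of m n] unfolding P_def by metis
  qed
  then obtain M where M: "\<And>m n. P m n (M m n)" by metis
  define Q where "Q = (\<lambda>f g D. D > 0 \<and> continuous_on UNIV (plane_conv f g) \<and>
    (\<forall>K x y. K \<ge> 1 \<longrightarrow> \<bar>x\<bar> \<le> 1 \<longrightarrow> \<bar>y\<bar> \<le> 1 \<longrightarrow>
      cmod (trig_conv K f g (x, y) - plane_conv f g (x, y)) \<le> D / real K))"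
  \<comment> \<open>The condition stands inside the existential so that \<open>D\<close> can be
    chosen as a total function.\<close>
  have "\<exists>D. good f \<and> good g \<longrightarrow> Q f g D" for f g
  proof (cases "good f \<and> good g")
    case True
    obtain B1 where B1: "B1 > 0" "lipschitz_bump B1 f"
      using True C1_plane_imp_lipschitz_bump[of f] unfolding good_def by auto
    obtain B2 where B2: "B2 > 0" "lipschitz_bump B2 g"
      using True C1_plane_imp_lipschitz_bump[of g] unfolding good_def by auto
    define B where "B = max B1 B2"
    have B: "B > 0" "lipschitz_bump B f" "lipschitz_bump B g"
      using B1 B2 lipschitz_bump_mono[OF B1(2), of B] lipschitz_bump_mono[OF B2(2), of B]
      by (auto simp: B_def)
    have "8 * pi + 24 > 0" using pi_gt_zero by linarith
    then have "(8 * pi + 24) * B\<^sup>2 > 0" using B(1) by simp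
    then have "Q f g ((8 * pi + 24) * B\<^sup>2)"
      unfolding Q_def using continuous_on_plane_conv[OF B(2,3)] trig_conv_error[OF B(2,3)] by blast
    then show ?thesis by blast
  qed blast
  then obtain D where D: "\<And>f g. good f \<and> good g \<Longrightarrow> Q f g (D f g)" by metis
  show ?thesis
  proof (rule exI[of _ M], rule exI[of _ D], intro allI impI conjI)
    fix m :: int and n :: nat and f g :: "real \<times> real \<Rightarrow> complex"
    assume "n \<ge> 1 \<and> C1_plane f \<and> C1_plane g \<and> supp f \<subseteq> ball 0 (1 / 2) \<and> supp g \<subseteq> ball 0 (1 / 2)"
    then have n: "n \<ge> 1" and Q: "Q f g (D f g)" using D by (auto simp: good_def)
    show M0: "M m n > 0" using M[of m n] by (simp add: P_def)
    show D0: "D f g > 0" using Q by (simp add: Q_def)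
    fix K :: nat
    assume K: "K \<ge> 1 \<and> int K \<ge> K_min m n"
    have "cmod (FB_coeff m n (trig_conv K f g) - FB_coeff m n (plane_conv f g)) \<le> M m n * (D f g / real K)"
    proof -
      have "continuous_on UNIV (plane_conv f g)"
        "\<forall>x y. \<bar>x\<bar> \<le> 1 \<longrightarrow> \<bar>y\<bar> \<le> 1 \<longrightarrow> cmod (trig_conv K f g (x, y) - plane_conv f g (x, y)) \<le> D f g / real K"
        using Q K unfolding Q_def by blast+
      then show ?thesis using M[of m n] continuous_on_trig_conv[of UNIV K f g] unfolding P_def by blast
    qed
    \<comment> \<open>All factors are positive, so the factor 2 only enlarges the bound.\<close>
    also have "\<dots> \<le> 2 * M m n * D f g / real K"
      using M0 D0 K by (simp add: field_simps)
    finally show "cmod (FB_approx K m n f g - FB_coeff m n (plane_conv f g)) \<le> 2 * M m n * D f g / real K"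
      unfolding FB_approx_eq_FB_coeff[OF n] .
  qed
qed

end
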